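(* Let $G$ be a plane elementary bipartite graph and let $G^*$ be the inner dual of $G$. Then the resonance graph $R(G)$ is a daisy cube if and only if $G^*$ is a tree and $R(G)$ is isomorphic to $D_{\mathcal{I}}(G^* )$ (or, equivalently, to the simplex graph $\mathcal{K}(\overline{G^*})$).
   Context: All graphs are finite. An edge of a graph with a perfect matching is allowed if it lies in some perfect matching. A graph (with a perfect matching) is elementary if all its allowed edges form a connected subgraph; $K_2$ is elementary. The inner dual $G^*$ of a plane graph $G$ has the finite (bounded) faces of $G$ as vertices, two being adjacent if the two faces have an edge in common. If $G=K_2$ then $G^*$ is the null graph (no vertices), which is regarded as a tree here; its only independent set is the empty set, and $D_{\mathcal{I}}(G^* )$ is the one-vertex graph. Resonance graph: the vertices of $R(G)$ are the perfect matchings of $G$; two perfect matchings are adjacent if their symmetric difference is the edge set of exactly one cycle which is the periphery of a finite face of $G$. Let $\mathcal{B}^n$ be the set of binary strings of length $n$ with the componentwise order $\le$; the hypercube $Q_n$ has vertex set $\mathcal{B}^n$, strings being adjacent if they differ in exactly one position. A daisy cube is (a graph isomorphic to) an induced subgraph of some $Q_n$ whose vertex set is a downward closed subset of $(\mathcal{B}^n,\le)$. For a graph $H$ with vertex set $\{v_1,\dots,v_n\}$ and $A\subseteq V(H)$, $\chi(A)\in\mathcal{B}^n$ is the string with $j$-th position $1$ if $v_j\in A$ and $0$ otherwise. $D_{\mathcal{I}}(H)$ is the induced subgraph of $Q_n$ on $\{u\in\mathcal{B}^n\mid u\le\chi(I)\text{ for some maximal independent set } I \text{ of } H\}$. The simplex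 graph $\mathcal{K}(F)$ of a graph $F$ has as vertices the cliques of $F$ (including the empty set), two cliques being adjacent if they differ in exactly one vertex. $\overline{H}$ denotes the complement of $H$. *)

theory Defs
  imports "HOL-Analysis.Analysis"
begin

section \<open>Finite simple graphs\<close>

record 'a ugraph =
  verts :: "'a set"
  edges :: "'a set set"

definition fin_graph :: "'a ugraph \<Rightarrow> bool" where
  "fin_graph G \<longleftrightarrow> finite (verts G) \<and>
     (\<forall>e\<in>edges G. \<exists>u\<in>verts G. \<exists>v\<in>verts G. u \<noteq> v \<and> e = {u, v})"

definition graph_iso :: "'a ugraph \<Rightarrow> 'b ugraph \<Rightarrow> bool" where
  "graph_iso G H \<longleftrightarrow> (\<exists>f. bij_betw f (verts G) (verts H) \<and>
     (\<forall>u\<in>verts G. \<forall>v\<in>verts G. {u, v} \<in> edges G \<longleftrightarrow> {f u, f v} \<in> edges H))"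

definition induced :: "'a ugraph \<Rightarrow> 'a set \<Rightarrow> 'a ugraph" where
  "induced G U = \<lparr>verts = verts G \<inter> U, edges = {e \<in> edges G. e \<subseteq> U}\<rparr>"

definition complement_graph :: "'a ugraph \<Rightarrow> 'a ugraph" where
  "complement_graph G = \<lparr>verts = verts G,
     edges = {{u, v} | u v. u \<in> verts G \<and> v \<in> verts G \<and> u \<noteq> v \<and> {u, v} \<notin> edges G}\<rparr>"

definition connected_graph :: "'a ugraph \<Rightarrow> bool" where
  "connected_graph G \<longleftrightarrow> verts G \<noteq> {} \<and>
     (\<forall>u\<in>verts G. \<forall>v\<in>verts G. (u, v) \<in> {(x, y). {x, y} \<in> edges G}\<^sup>*)"

definition bipartite_graph :: "'a ugraph \<Rightarrow> bool" where
  "bipartite_graph G \<longleftrightarrow> (\<exists>A B. A \<union> B = verts G \<and> A \<inter> B = {} \<and>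
     (\<forall>e\<in>edges G. \<exists>a\<in>A. \<exists>b\<in>B. e = {a, b}))"

text \<open>A cycle is given by the cyclic list of its vertices.\<close>

definition cycle_edges :: "'a list \<Rightarrow> 'a set set" where
  "cycle_edges p = {{p ! i, p ! (Suc i mod length p)} | i. i < length p}"

definition is_cycle :: "'a ugraph \<Rightarrow> 'a list \<Rightarrow> bool" where
  "is_cycle G p \<longleftrightarrow> 3 \<le> length p \<and> distinct p \<and> set p \<subseteq> verts G \<and> cycle_edges p \<subseteq> edges G"

text \<open>The null graph counts as a tree.\<close>

definition tree_graph :: "'a ugraph \<Rightarrow> bool" where
  "tree_graph G \<longleftrightarrow> verts G = {} \<or> connected_graph G \<and> (\<nexists>p. is_cycle G p)"

definition independent_set :: "'a ugraph \<Rightarrow> 'a set \<Rightarrow> bool" where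
  "independent_set G I \<longleftrightarrow> I \<subseteq> verts G \<and> (\<forall>u\<in>I. \<forall>v\<in>I. {u, v} \<notin> edges G)"

definition max_independent_set :: "'a ugraph \<Rightarrow> 'a set \<Rightarrow> bool" where
  "max_independent_set G I \<longleftrightarrow> independent_set G I \<and>
     (\<forall>J. independent_set G J \<and> I \<subseteq> J \<longrightarrow> J = I)"

definition clique :: "'a ugraph \<Rightarrow> 'a set \<Rightarrow> bool" where
  "clique G K \<longleftrightarrow> K \<subseteq> verts G \<and> (\<forall>u\<in>K. \<forall>v\<in>K. u \<noteq> v \<longrightarrow> {u, v} \<in> edges G)"

definition simplex_graph :: "'a ugraph \<Rightarrow> 'a set ugraph" where
  "simplex_graph G = \<lparr>verts = {K. clique G K},
     edges = {{K, L} | K L. clique G K \<and> clique G L \<and> card ((K - L) \<union> (L - K)) = 1}\<rparr>"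


section \<open>Perfect matchings\<close>

definition perfect_matching :: "'a ugraph \<Rightarrow> 'a set set \<Rightarrow> bool" where
  "perfect_matching G M \<longleftrightarrow> M \<subseteq> edges G \<and> (\<forall>v\<in>verts G. \<exists>!e. e \<in> M \<and> v \<in> e)"

definition allowed_edges :: "'a ugraph \<Rightarrow> 'a set set" where
  "allowed_edges G = {e. \<exists>M. perfect_matching G M \<and> e \<in> M}"

definition elementary_graph :: "'a ugraph \<Rightarrow> bool" where
  "elementary_graph G \<longleftrightarrow> (\<exists>M. perfect_matching G M) \<and>
     connected_graph \<lparr>verts = \<Union>(allowed_edges G), edges = allowed_edges G\<rparr>"


section \<open>Daisy cubes\<close>

definition bin_strings :: "nat \<Rightarrow> bool list set" where
  "bin_strings n = {u. length u = n}"

definition string_le :: "bool list \<Rightarrow> bool list \<Rightarrow> bool" where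
  "string_le u v \<longleftrightarrow> list_all2 (\<le>) u v"

definition hypercube :: "nat \<Rightarrow> bool list ugraph" where
  "hypercube n = \<lparr>verts = bin_strings n,
     edges = {{u, v} | u v. u \<in> bin_strings n \<and> v \<in> bin_strings n \<and>
                card {i. i < n \<and> u ! i \<noteq> v ! i} = 1}\<rparr>"

definition daisy_cube :: "'a ugraph \<Rightarrow> bool" where
  "daisy_cube G \<longleftrightarrow> (\<exists>n U. U \<subseteq> bin_strings n \<and>
     (\<forall>u v. v \<in> U \<and> string_le u v \<longrightarrow> u \<in> U) \<and>
     graph_iso G (induced (hypercube n) U))"

definition char_string :: "'a list \<Rightarrow> 'a set \<Rightarrow> bool list" where
  "char_string vs A = map (\<lambda>v. v \<in> A) vs"

definition DI_wrt :: "'a list \<Rightarrow> 'a ugraph \<Rightarrow> bool list ugraph" where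
  "DI_wrt vs H = induced (hypercube (length vs))
     {u \<in> bin_strings (length vs). \<exists>I. max_independent_set H I \<and> string_le u (char_string vs I)}"

text \<open>The enumeration of the (finitely many) vertices is arbitrary; lemma
  \<open>graph_iso_DI\<close> below shows that it does not matter up to isomorphism.\<close>

definition DI :: "'a ugraph \<Rightarrow> bool list ugraph" where
  "DI H = DI_wrt (SOME vs. distinct vs \<and> set vs = verts H) H"

lemma char_string_diff:
  assumes "distinct vs" "A \<subseteq> set vs" "B \<subseteq> set vs"
  shows "card {i. i < length vs \<and> char_string vs A ! i \<noteq> char_string vs B ! i}
    = card ((A - B) \<union> (B - A))"
proof (rule bij_betw_same_card[where f = "(!) vs"])
  show "bij_betw ((!) vs) {i. i < length vs \<and> char_string vs A ! i \<noteq> char_string vs B ! i}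
     ((A - B) \<union> (B - A))"
    unfolding bij_betw_def
  proof
    show "inj_on ((!) vs) {i. i < length vs \<and> char_string vs A ! i \<noteq> char_string vs B ! i}"
      using assms(1) by (auto simp: inj_on_def nth_eq_iff_index_eq)
    show "(!) vs ` {i. i < length vs \<and> char_string vs A ! i \<noteq> char_string vs B ! i}
      = (A - B) \<union> (B - A)"
    proof (intro equalityI subsetI)
      fix x assume "x \<in> (A - B) \<union> (B - A)"
      moreover from this obtain i where "i < length vs" "x = vs ! i"
        using assms by (metis DiffD1 UnE in_set_conv_nth subsetD)
      ultimately show "x \<in> (!) vs ` {i. i < length vs \<and> char_string vs A ! i \<noteq> char_string vs B ! i}"
        by (auto simp: char_string_def)
    qed (auto simp: char_string_def)
  qed
qed

lemma char_string_bij: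
  assumes "distinct vs"
  shows "bij_betw (char_string vs) (Pow (set vs)) (bin_strings (length vs))"
proof -
  have inj: "inj_on (char_string vs) (Pow (set vs))"
    by (auto simp: inj_on_def char_string_def)
  have "card (bin_strings (length vs)) = 2 ^ length vs"
    using card_lists_length_eq[of "UNIV :: bool set" "length vs"]
    by (simp add: bin_strings_def)
  moreover have "card (char_string vs ` Pow (set vs)) = 2 ^ length vs"
    using assms by (simp add: card_image[OF inj] card_Pow distinct_card)
  moreover have "finite (bin_strings (length vs))"
    using finite_lists_length_eq[of "UNIV :: bool set" "length vs"] by (simp add: bin_strings_def)
  moreover have "char_string vs ` Pow (set vs) \<subseteq> bin_strings (length vs)"
    by (auto simp: char_string_def bin_strings_def)
  ultimately have "char_string vs ` Pow (set vs) = bin_strings (length vs)"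
    by (intro card_subset_eq) auto
  with inj show ?thesis by (simp add: bij_betw_def)
qed

lemma char_string_le:
  assumes "A \<subseteq> set vs"
  shows "string_le (char_string vs A) (char_string vs B) \<longleftrightarrow> A \<subseteq> B"
  using assms by (auto simp: string_le_def char_string_def list_all2_map1 list_all2_map2
      list_all2_same)

lemma DI_wrt_char_string:
  assumes "distinct vs" "set vs = verts H"
  defines "S \<equiv> {A. \<exists>I. max_independent_set H I \<and> A \<subseteq> I}"
  shows "bij_betw (char_string vs) S (verts (DI_wrt vs H))"
    and "\<And>A B. A \<in> S \<Longrightarrow> B \<in> S \<Longrightarrow>
      {char_string vs A, char_string vs B} \<in> edges (DI_wrt vs H) \<longleftrightarrow> card ((A - B) \<union> (B - A)) = 1"
proof -
  have S: "S \<subseteq> Pow (set vs)"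
    using assms by (auto simp: S_def max_independent_set_def independent_set_def)
  have img: "char_string vs ` S = verts (DI_wrt vs H)"
  proof (intro equalityI subsetI)
    fix u assume "u \<in> char_string vs ` S"
    then obtain A I where A: "u = char_string vs A" "A \<subseteq> I" "max_independent_set H I"
      by (auto simp: S_def)
    with S have "string_le u (char_string vs I)"
      using char_string_le[of A vs I] by (auto simp: S_def)
    with A show "u \<in> verts (DI_wrt vs H)"
      by (auto simp: DI_wrt_def induced_def hypercube_def bin_strings_def char_string_def)
  next
    fix u assume "u \<in> verts (DI_wrt vs H)"
    then obtain I where u: "u \<in> bin_strings (length vs)" "max_independent_set H I"
      "string_le u (char_string vs I)"
      by (auto simp: DI_wrt_def induced_def)
    then obtain A where "A \<subseteq> set vs" "u = char_string vs A"
      using char_string_bij[OF assms(1)] by (auto simp: bij_betw_def)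
    with u show "u \<in> char_string vs ` S"
      using char_string_le[of A vs I] by (auto simp: S_def)
  qed
  show "bij_betw (char_string vs) S (verts (DI_wrt vs H))"
    using bij_betw_subset[OF char_string_bij[OF assms(1)] S img] .
  fix A B assume AB: "A \<in> S" "B \<in> S"
  let ?d = "\<lambda>u v. card {i. i < length vs \<and> u ! i \<noteq> v ! i}"
  have comm: "?d u v = ?d v u" for u v :: "bool list"
    by (rule arg_cong[where f = card]) auto
  have "{u, v} \<in> edges (DI_wrt vs H) \<longleftrightarrow> ?d u v = 1"
    if "u \<in> verts (DI_wrt vs H)" "v \<in> verts (DI_wrt vs H)" for u v
    using that comm[of u v] by (auto simp: DI_wrt_def induced_def hypercube_def doubleton_eq_iff)
  then have "{char_string vs A, char_string vs B} \<in> edges (DI_wrt vs H)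
      \<longleftrightarrow> ?d (char_string vs A) (char_string vs B) = 1"
    using AB img by blast
  then show "{char_string vs A, char_string vs B} \<in> edges (DI_wrt vs H)
      \<longleftrightarrow> card ((A - B) \<union> (B - A)) = 1"
    using char_string_diff[OF assms(1), of A B] AB S by (simp add: subset_iff)
qed

lemma graph_iso_DI:
  assumes "distinct vs" "set vs = verts H"
  shows "graph_iso (DI_wrt vs H) (DI H)"
proof -
  define ws where "ws = (SOME vs. distinct vs \<and> set vs = verts H)"
  have "distinct ws \<and> set ws = verts H"
    unfolding ws_def by (rule someI[of _ vs]) (use assms in auto)
  then have ws: "distinct ws" "set ws = verts H" by auto
  define S where "S = {A. \<exists>I. max_independent_set H I \<and> A \<subseteq> I}"
  note V = DI_wrt_char_string[OF assms, folded S_def]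
  note W = DI_wrt_char_string[OF ws, folded S_def]
  define g where "g = the_inv_into S (char_string vs)"
  have g: "bij_betw g (verts (DI_wrt vs H)) S"
    unfolding g_def using V(1) by (rule bij_betw_the_inv_into)
  have cg: "char_string vs (g u) = u" if "u \<in> verts (DI_wrt vs H)" for u
    unfolding g_def using V(1) that by (intro f_the_inv_into_f) (auto simp: bij_betw_def)
  have "bij_betw (char_string ws \<circ> g) (verts (DI_wrt vs H)) (verts (DI_wrt ws H))"
    using g W(1) by (rule bij_betw_trans)
  moreover have "{u, v} \<in> edges (DI_wrt vs H)
      \<longleftrightarrow> {(char_string ws \<circ> g) u, (char_string ws \<circ> g) v} \<in> edges (DI_wrt ws H)"
    if "u \<in> verts (DI_wrt vs H)" "v \<in> verts (DI_wrt vs H)" for u v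
  proof -
    have "g u \<in> S" "g v \<in> S" using g that by (auto simp: bij_betw_def)
    then show ?thesis using V(2)[of "g u" "g v"] W(2)[of "g u" "g v"] cg that by simp
  qed
  ultimately have "graph_iso (DI_wrt vs H) (DI_wrt ws H)"
    unfolding graph_iso_def by blast
  then show ?thesis by (simp add: DI_def ws_def)
qed


section \<open>Plane graphs\<close>

text \<open>The vertices of a plane graph are points of the plane (here: the complex plane), and every
  edge \<open>{u, v}\<close> is drawn as a simple arc \<open>\<gamma> {u, v}\<close> joining \<open>u\<close> and \<open>v\<close>, whose
  interior meets neither vertices nor other edges.\<close>

definition plane_graph :: "complex ugraph \<Rightarrow> (complex set \<Rightarrow> real \<Rightarrow> complex) \<Rightarrow> bool" where
  "plane_graph G \<gamma> \<longleftrightarrow> fin_graph G \<and>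
     (\<forall>e\<in>edges G. arc (\<gamma> e) \<and> {pathstart (\<gamma> e), pathfinish (\<gamma> e)} = e \<and>
        path_image (\<gamma> e) \<inter> verts G = e) \<and>
     (\<forall>e\<in>edges G. \<forall>e'\<in>edges G. e \<noteq> e' \<longrightarrow>
        path_image (\<gamma> e) \<inter> path_image (\<gamma> e') = e \<inter> e')"

definition drawing :: "complex ugraph \<Rightarrow> (complex set \<Rightarrow> real \<Rightarrow> complex) \<Rightarrow> complex set" where
  "drawing G \<gamma> = verts G \<union> (\<Union>e\<in>edges G. path_image (\<gamma> e))"

definition finite_faces :: "complex ugraph \<Rightarrow> (complex set \<Rightarrow> real \<Rightarrow> complex) \<Rightarrow> complex set set" where
  "finite_faces G \<gamma> = {F \<in> components (- drawing G \<gamma>). bounded F}"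

definition inner_dual ::
    "complex ugraph \<Rightarrow> (complex set \<Rightarrow> real \<Rightarrow> complex) \<Rightarrow> complex set ugraph" where
  "inner_dual G \<gamma> = \<lparr>verts = finite_faces G \<gamma>,
     edges = {{F, F'} | F F'. F \<in> finite_faces G \<gamma> \<and> F' \<in> finite_faces G \<gamma> \<and> F \<noteq> F' \<and>
       (\<exists>e\<in>edges G. path_image (\<gamma> e) \<subseteq> frontier F \<and> path_image (\<gamma> e) \<subseteq> frontier F')}\<rparr>"

text \<open>The periphery of a face is its topological boundary; the cycle \<open>p\<close> is the periphery of
  \<open>F\<close> if its drawing is the boundary of \<open>F\<close>.\<close>

definition is_periphery ::
    "complex ugraph \<Rightarrow> (complex set \<Rightarrow> real \<Rightarrow> complex) \<Rightarrow> complex list \<Rightarrow> complex set \<Rightarrow> bool" where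
  "is_periphery G \<gamma> p F \<longleftrightarrow>
     is_cycle G p \<and> frontier F = (\<Union>e\<in>cycle_edges p. path_image (\<gamma> e))"

definition resonance_graph ::
    "complex ugraph \<Rightarrow> (complex set \<Rightarrow> real \<Rightarrow> complex) \<Rightarrow> complex set set ugraph" where
  "resonance_graph G \<gamma> = \<lparr>verts = {M. perfect_matching G M},
     edges = {{M, N} | M N. perfect_matching G M \<and> perfect_matching G N \<and>
       (\<exists>F\<in>finite_faces G \<gamma>. \<exists>p. is_periphery G \<gamma> p F \<and>
          (M - N) \<union> (N - M) = cycle_edges p)}\<rparr>"

end

theory Submission
  imports Defs "HOL-Complex_Analysis.Complex_Analysis"
begin

text \<open>
  Why the theorem holds. Fix the bipartition \<open>A\<close>, \<open>B\<close> of \<open>G\<close> and direct every edge from \<open>A\<close> to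
  \<open>B\<close>. For a point \<open>z\<close> off the drawing let the height of a perfect matching be the sum of the
  winding numbers of its edges about \<open>z\<close>. If two matchings differ by the periphery of a face \<open>F\<close>, then
  by the Jordan curve theorem their heights differ by \<open>\<plusminus>1\<close> for \<open>z \<in> F\<close> and agree for
  \<open>z \<notin> F\<close> (\<open>height_diff_face\<close>). So along a closed walk in the resonance graph every face is rotated
  an even number of times; in particular the opposite sides of a 4-cycle rotate the same faces
  (\<open>rotation_square\<close>).

  Let now \<open>R(G)\<close> be a daisy cube, that is, a family \<open>S\<close> of sets that is closed under subsets, with sets
  adjacent if they differ in one element. By the 4-cycles, adding an element \<open>i\<close> to a set always rotates
  the same face \<open>face i\<close>. If \<open>{i, j} \<in> S\<close>, the two faces have disjoint peripheries
  (\<open>commuting_rotations_subset\<close>), and conversely pairwise disjoint faces can be rotated independently.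
  Since all faces \<open>face i\<close> are alternating for the matching of the empty set, two of them that share a
  vertex share an edge. Hence \<open>S\<close> consists of the independent sets of the inner dual, provided that every
  finite face occurs as some \<open>face i\<close>.

  This last point rests on two facts. First, an edge weight whose sum is the same for all perfect
  matchings of an elementary bipartite graph is the difference of a potential on the vertices
  (\<open>potential_of_matching_invariant\<close>). Second, if two points off the drawing give the same heights up to
  a constant, they lie in the same face (\<open>same_height_imp_connected\<close>): the potential glues the
  logarithms along the edges to a continuous logarithm on the drawing, and Borsuk's criterion applies. A
  face that is never rotated would have constant height, like a point far away. The same argument
  shows that there are finitely many faces.

  It remains to see that the inner dual is a tree. It is connected because \<open>G\<close> is. Suppose that it has a
  cycle in which \<open>F\<close> has the neighbours \<open>X\<close> and \<open>Y\<close>. By Janiszewski's theorem an edge lies on at most two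
  finite faces (\<open>edge_on_two_faces\<close>). Therefore cutting the periphery of \<open>F\<close> around the part shared with
  \<open>X\<close> only uses edges that belong to no other face, and the cut gives a weight that is invariant as
  above. Its potential is constant on each face other than \<open>F\<close>, hence along the rest of the cycle from
  \<open>X\<close> to \<open>Y\<close>, but it takes different values where \<open>F\<close> meets \<open>X\<close> and where \<open>F\<close> meets \<open>Y\<close>
  (\<open>cut_potential\<close>, \<open>dual_acyclic\<close>).

  Finally, \<open>DI\<close> of the inner dual and the simplex graph of its complement are the same graph on the
  independent sets (\<open>DI_iso_simplex\<close>), and \<open>DI\<close> of a graph is a daisy cube by definition.
\<close>

section \<open>Cycles\<close>

lemma cycle_edges_image:
  "cycle_edges p = (\<lambda>i. {p ! i, p ! (Suc i mod length p)}) ` {..<length p}"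
  by (auto simp: cycle_edges_def)

lemma cycle_induct_connected:
  assumes p: "is_cycle H p" and u: "u \<in> set p" "P u"
    and step: "\<And>x y. {x, y} \<in> cycle_edges p \<Longrightarrow> P x \<Longrightarrow> P y"
    and v: "v \<in> set p"
  shows "P v"
proof -
  define k where "k = length p"
  have k: "3 \<le> k" using p by (simp add: is_cycle_def k_def)
  obtain i j where ij: "i < k" "u = p ! i" "j < k" "v = p ! j"
    using u v by (metis in_set_conv_nth k_def)
  have "P (p ! ((i + n) mod k))" for n
  proof (induction n)
    case (Suc n)
    have "{p ! ((i + n) mod k), p ! (Suc ((i + n) mod k) mod k)} \<in> cycle_edges p"
      using k by (auto simp: cycle_edges_def k_def[symmetric] intro!: exI[of _ "(i + n) mod k"])
    with Suc.IH step have "P (p ! (Suc ((i + n) mod k) mod k))" by blast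
    then show ?case by (simp add: mod_Suc_eq)
  qed (use ij u in simp)
  from this[of "k - i + j"] show ?thesis using ij by simp
qed

lemma Union_cycle_edges:
  assumes "is_cycle H p"
  shows "\<Union>(cycle_edges p) = set p"
proof (intro equalityI subsetI)
  have len: "length p > 0" using assms by (auto simp: is_cycle_def)
  show "x \<in> set p" if "x \<in> \<Union>(cycle_edges p)" for x
    using that len by (auto simp: cycle_edges_image)
  fix x assume "x \<in> set p"
  then obtain i where "i < length p" "x = p ! i" by (auto simp: in_set_conv_nth)
  then show "x \<in> \<Union>(cycle_edges p)" by (auto simp: cycle_edges_image)
qed


section \<open>Perfect matchings of bipartite graphs\<close>

locale bipartition =
  fixes G :: "'a ugraph" and A B :: "'a set"
  assumes fin: "fin_graph G"
    and parts: "A \<union> B = verts G" "A \<inter> B = {}"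
    and bip: "e \<in> edges G \<Longrightarrow> \<exists>a\<in>A. \<exists>b\<in>B. e = {a, b}"
begin

lemma finite_parts: "finite A" "finite B"
  using fin parts by (auto simp: fin_graph_def intro: finite_subset)

lemma edge_subset_verts: "e \<in> edges G \<Longrightarrow> e \<subseteq> verts G"
  using bip parts by blast

lemma finite_edges: "finite (edges G)"
proof (rule finite_subset)
  show "edges G \<subseteq> Pow (verts G)" using edge_subset_verts by blast
  show "finite (Pow (verts G))" using fin by (simp add: fin_graph_def)
qed

lemma matching_unique:
  assumes "perfect_matching G M" "e \<in> M" "f \<in> M" "v \<in> e" "v \<in> f"
  shows "e = f"
proof -
  have "v \<in> verts G"
    using assms edge_subset_verts by (auto simp: perfect_matching_def)
  with assms show ?thesis unfolding perfect_matching_def by blast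
qed

lemma matching_edges: "perfect_matching G M \<Longrightarrow> M \<subseteq> edges G"
  by (simp add: perfect_matching_def)

lemma matching_covers:
  assumes "perfect_matching G M" "v \<in> verts G"
  shows "\<exists>e\<in>M. v \<in> e"
  using assms unfolding perfect_matching_def by blast

lemma finite_matching: "perfect_matching G M \<Longrightarrow> finite M"
  using finite_edges finite_subset matching_edges by blast

lemma finite_matchings: "finite {M. perfect_matching G M}"
  by (rule finite_subset[of _ "Pow (edges G)"]) (use matching_edges finite_edges in auto)

lemma pair_edge_inj:
  assumes "\<nu> \<in> A \<rightarrow> B"
  shows "inj_on (\<lambda>a. {a, \<nu> a}) A"
  using assms parts by (force simp: inj_on_def doubleton_eq_iff)

lemma matching_of_bij:
  assumes bij: "bij_betw \<nu> A B" and edge: "\<And>a. a \<in> A \<Longrightarrow> {a, \<nu> a} \<in> edges G"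
  shows "perfect_matching G ((\<lambda>a. {a, \<nu> a}) ` A)"
  unfolding perfect_matching_def
proof (intro conjI ballI)
  show "(\<lambda>a. {a, \<nu> a}) ` A \<subseteq> edges G" using edge by blast
  have im: "\<nu> ` A = B" and inj: "inj_on \<nu> A" using bij by (auto simp: bij_betw_def)
  fix v assume "v \<in> verts G"
  then consider "v \<in> A" | "v \<in> B" using parts by blast
  then show "\<exists>!e. e \<in> (\<lambda>a. {a, \<nu> a}) ` A \<and> v \<in> e"
  proof cases
    case 1
    then show ?thesis using im parts by (intro ex1I[of _ "{v, \<nu> v}"]) auto
  next
    case 2
    then obtain a where a: "a \<in> A" "v = \<nu> a" using im by blast
    show ?thesis
    proof (rule ex1I[of _ "{a, \<nu> a}"])
      show "{a, \<nu> a} \<in> (\<lambda>a. {a, \<nu> a}) ` A \<and> v \<in> {a, \<nu> a}" using a by blast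
      fix e assume "e \<in> (\<lambda>a. {a, \<nu> a}) ` A \<and> v \<in> e"
      then obtain x where x: "x \<in> A" "e = {x, \<nu> x}" "v = x \<or> v = \<nu> x" by blast
      with 2 parts have "v = \<nu> x" by blast
      with a x inj have "x = a" by (auto dest: inj_onD)
      with x show "e = {a, \<nu> a}" by simp
    qed
  qed
qed

lemma matching_bij:
  assumes M: "perfect_matching G M"
  obtains \<nu> where "bij_betw \<nu> A B" "M = (\<lambda>a. {a, \<nu> a}) ` A"
proof -
  have "\<exists>b. b \<in> B \<and> {a, b} \<in> M" if a: "a \<in> A" for a
  proof -
    obtain e where e: "e \<in> M" "a \<in> e" using matching_covers[OF M, of a] parts(1) a by blast
    then obtain x b where "x \<in> A" "b \<in> B" "e = {x, b}" using bip matching_edges[OF M] by blast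
    with e a parts show ?thesis by blast
  qed
  then obtain \<nu> where nu: "\<And>a. a \<in> A \<Longrightarrow> \<nu> a \<in> B \<and> {a, \<nu> a} \<in> M" by metis
  have "inj_on \<nu> A"
  proof (rule inj_onI)
    fix x y assume xy: "x \<in> A" "y \<in> A" "\<nu> x = \<nu> y"
    have "{x, \<nu> x} = {y, \<nu> y}"
      by (rule matching_unique[OF M, of _ _ "\<nu> x"]) (use nu[OF xy(1)] nu[OF xy(2)] xy(3) in auto)
    moreover have "x \<noteq> \<nu> y" using nu xy parts by blast
    ultimately show "x = y" by (auto simp: doubleton_eq_iff)
  qed
  moreover have MA: "e \<in> (\<lambda>a. {a, \<nu> a}) ` A" if e: "e \<in> M" for e
  proof -
    obtain a b where ab: "a \<in> A" "b \<in> B" "e = {a, b}" using bip e matching_edges[OF M] by blast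
    then have "e = {a, \<nu> a}" using matching_unique[OF M, of e "{a, \<nu> a}" a] nu e by auto
    with ab show ?thesis by blast
  qed
  moreover have "b \<in> \<nu> ` A" if b: "b \<in> B" for b
  proof -
    obtain e where e: "e \<in> M" "b \<in> e" using matching_covers[OF M, of b] parts(1) b by blast
    then obtain a where "a \<in> A" "e = {a, \<nu> a}" using MA by blast
    with e b parts show ?thesis by blast
  qed
  ultimately show thesis
    using nu by (intro that[of \<nu>]) (auto simp: bij_betw_def)
qed

end


section \<open>Weights of closed walks\<close>

fun walk_weight :: "('a \<Rightarrow> 'a \<Rightarrow> 'b::ab_group_add) \<Rightarrow> 'a list \<Rightarrow> 'b" where
  "walk_weight t (x # y # xs) = t x y + walk_weight t (y # xs)"
| "walk_weight t xs = 0"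

lemma walk_weight_append:
  "walk_weight t (xs @ y # ys) = walk_weight t (xs @ [y]) + walk_weight t (y # ys)"
  by (induction t xs rule: walk_weight.induct) (auto simp: algebra_simps)

lemma walk_weight_closed:
  "walk_weight t (xs @ [hd xs]) = (\<Sum>i<length xs. t (xs ! i) (xs ! (Suc i mod length xs)))"
proof -
  have *: "walk_weight t ys = (\<Sum>i<length ys - 1. t (ys ! i) (ys ! Suc i))" for ys
  proof (induction t ys rule: walk_weight.induct)
    case (1 t x y xs)
    then show ?case
      using sum.lessThan_Suc_shift[of "\<lambda>i. t ((x # y # xs) ! i) ((x # y # xs) ! Suc i)" "length xs"]
      by simp
  qed auto
  show ?thesis
  proof (cases "xs = []")
    case False
    have "t ((xs @ [hd xs]) ! i) ((xs @ [hd xs]) ! Suc i) = t (xs ! i) (xs ! (Suc i mod length xs))"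
      if "i < length xs" for i
      using that False by (cases "Suc i = length xs") (auto simp: nth_append hd_conv_nth)
    then show ?thesis by (simp add: *)
  qed simp
qed

text \<open>A closed walk that repeats a vertex splits there into two shorter closed walks, so it is
  enough to know the weights of cycles.\<close>

lemma closed_walk_weight_zero:
  fixes t :: "'a \<Rightarrow> 'a \<Rightarrow> 'b::ab_group_add"
  assumes cyc: "\<And>xs. distinct xs \<Longrightarrow> xs \<noteq> [] \<Longrightarrow> successively R (xs @ [hd xs]) \<Longrightarrow>
      walk_weight t (xs @ [hd xs]) = 0"
    and "successively R (xs @ [hd xs])" "xs \<noteq> []"
  shows "walk_weight t (xs @ [hd xs]) = 0"
  using assms(2,3)
proof (induction "length xs" arbitrary: xs rule: less_induct)
  case less
  show ?case
  proof (cases "distinct xs")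
    case True
    then show ?thesis using cyc less.prems by blast
  next
    case False
    then obtain us y vs ws where xs: "xs = us @ [y] @ vs @ [y] @ ws"
      using not_distinct_decomp by blast
    define inner where "inner = y # vs"
    define outer where "outer = us @ y # ws"
    have hd_outer: "hd outer = hd xs" by (cases us) (auto simp: outer_def xs)
    have whole: "xs @ [hd xs] = us @ y # (vs @ y # (ws @ [hd xs]))"
      by (simp add: xs)
    have "successively R (us @ y # (vs @ y # (ws @ [hd xs])))"
      using less.prems(1) whole by metis
    then have "successively R (us @ ((y # vs) @ (y # (ws @ [hd xs]))))" by simp
    then have "successively R (us @ (y # (ws @ [hd xs])))" "successively R ((y # vs) @ [y])"
      unfolding successively_append_iff by (auto simp: successively_append_iff)
    then have "successively R (outer @ [hd outer])" "successively R (inner @ [hd inner])"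
      unfolding hd_outer by (simp_all add: outer_def inner_def)
    then have zero: "walk_weight t (outer @ [hd outer]) = 0" "walk_weight t (inner @ [hd inner]) = 0"
      using less.hyps[of outer] less.hyps[of inner] by (auto simp: outer_def inner_def xs)
    have "walk_weight t (xs @ [hd xs])
        = walk_weight t (us @ [y]) + (walk_weight t ((y # vs) @ [y]) + walk_weight t (y # (ws @ [hd xs])))"
      unfolding whole
      using walk_weight_append[of t us y "vs @ y # (ws @ [hd xs])"]
        walk_weight_append[of t "y # vs" y "ws @ [hd xs]"] by simp
    also have "\<dots> = walk_weight t (outer @ [hd outer]) + walk_weight t (inner @ [hd inner])"
      unfolding hd_outer using walk_weight_append[of t us y "ws @ [hd xs]"]
      by (simp add: outer_def inner_def algebra_simps)
    finally show ?thesis using zero by simp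
  qed
qed

lemma rtrancl_walk:
  assumes "(x, y) \<in> R\<^sup>*"
  obtains xs where "successively (\<lambda>u v. (u, v) \<in> R) (xs @ [y])" "hd (xs @ [y]) = x"
  using assms
proof (induction arbitrary: thesis rule: converse_rtrancl_induct)
  case base
  show ?case using base[of "[]"] by simp
next
  case (step u v)
  obtain xs where "successively (\<lambda>u v. (u, v) \<in> R) (xs @ [y])" "hd (xs @ [y]) = v"
    using step.IH by blast
  then show ?case
    using step.hyps(1) by (intro step.prems[of "u # xs"]) (cases xs; auto)+
qed

text \<open>In a strongly connected digraph the potential of a vertex can be taken as the weight of any
  walk from a root: completing two such walks by the same way back shows that they agree.\<close>

lemma potential_of_closed_walks:
  fixes t :: "'a \<Rightarrow> 'a \<Rightarrow> 'b::ab_group_add"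
  assumes cyc: "\<And>xs. distinct xs \<Longrightarrow> xs \<noteq> [] \<Longrightarrow>
      successively (\<lambda>u v. (u, v) \<in> R) (xs @ [hd xs]) \<Longrightarrow> walk_weight t (xs @ [hd xs]) = 0"
    and conn: "\<And>x y. x \<in> V \<Longrightarrow> y \<in> V \<Longrightarrow> (x, y) \<in> R\<^sup>*"
    and RV: "R \<subseteq> V \<times> V"
  obtains \<pi> where "\<And>x y. (x, y) \<in> R \<Longrightarrow> t x y = \<pi> y - \<pi> x"
proof (cases "V = {}")
  case True
  then show ?thesis using RV that by blast
next
  case False
  let ?W = "successively (\<lambda>u v. (u, v) \<in> R)"
  obtain r where r: "r \<in> V" using False by blast
  have "\<exists>xs. ?W (xs @ [y]) \<and> hd (xs @ [y]) = r" if "y \<in> V" for y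
    using rtrancl_walk[OF conn[OF r that]] by metis
  then obtain P where P: "\<And>y. y \<in> V \<Longrightarrow> ?W (P y @ [y]) \<and> hd (P y @ [y]) = r" by metis
  define \<pi> where "\<pi> y = walk_weight t (P y @ [y])" for y
  show ?thesis
  proof (rule that[of \<pi>])
    fix x y assume xy: "(x, y) \<in> R"
    then have V: "x \<in> V" "y \<in> V" using RV by auto
    obtain Q where Q: "?W (Q @ [r])" "hd (Q @ [r]) = y"
      using rtrancl_walk[OF conn[OF V(2) r]] by metis
    have zero: "walk_weight t (ys @ Q @ [r]) = 0"
      if "?W (ys @ [y])" "hd (ys @ [y]) = r" for ys
    proof -
      have "?W (ys @ Q @ [r])"
        using that Q by (cases Q) (auto simp: successively_append_iff)
      moreover have "hd (ys @ Q) = r" if "ys @ Q \<noteq> []"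
        using \<open>hd (ys @ [y]) = r\<close> Q that by (cases ys; cases Q) auto
      ultimately show ?thesis
        using closed_walk_weight_zero[of "\<lambda>u v. (u, v) \<in> R" t "ys @ Q", OF cyc]
        by (cases "ys @ Q = []") auto
    qed
    obtain Q' where Q': "Q @ [r] = y # Q'" using Q by (cases Q) auto
    have split: "walk_weight t (ys @ Q @ [r]) = walk_weight t (ys @ [y]) + walk_weight t (Q @ [r])"
      for ys
      unfolding Q' by (rule walk_weight_append)
    have "?W ((P x @ [x]) @ [y])" "hd ((P x @ [x]) @ [y]) = r"
      using P[OF V(1)] xy by (auto simp: successively_append_iff hd_append)
    then have "walk_weight t ((P x @ [x]) @ [y]) = walk_weight t (P y @ [y])"
      using zero[of "P x @ [x]"] zero[of "P y"] P[OF V(2)] split[of "P x @ [x]"] split[of "P y"]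
      by (metis add_right_cancel)
    moreover have "walk_weight t ((P x @ [x]) @ [y]) = walk_weight t (P x @ [x]) + t x y"
      using walk_weight_append[of t "P x" x "[y]"] by simp
    ultimately show "t x y = \<pi> y - \<pi> x" by (simp add: \<pi>_def algebra_simps)
  qed
qed


section \<open>Potentials of matching-invariant edge weights\<close>

context bipartition
begin

text \<open>With respect to the matching \<open>\<mu>\<close>, a directed cycle of this relation is an alternating cycle
  of the graph: the step from \<open>x\<close> to \<open>y\<close> runs over an edge to the partner of \<open>y\<close> and
  back over the matching edge at \<open>y\<close>.\<close>

definition alternating_step :: "('a \<Rightarrow> 'a) \<Rightarrow> ('a \<times> 'a) set" where
  "alternating_step \<mu> = {(x, y). x \<in> A \<and> y \<in> A \<and> {x, \<mu> y} \<in> edges G}"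

definition step_weight :: "('a set \<Rightarrow> 'b::ab_group_add) \<Rightarrow> ('a \<Rightarrow> 'a) \<Rightarrow> 'a \<Rightarrow> 'a \<Rightarrow> 'b" where
  "step_weight w \<mu> x y = w {x, \<mu> y} - w {y, \<mu> y}"

lemma pair_in_matching:
  assumes "\<nu> \<in> A \<rightarrow> B" "x \<in> A" "b \<in> B"
  shows "{x, b} \<in> (\<lambda>a. {a, \<nu> a}) ` A \<longleftrightarrow> b = \<nu> x"
proof
  assume "{x, b} \<in> (\<lambda>a. {a, \<nu> a}) ` A"
  then obtain a where a: "a \<in> A" "{x, b} = {a, \<nu> a}" by blast
  moreover have "x \<noteq> \<nu> a" using Pi_mem[OF assms(1) a(1)] assms(2) parts by blast
  ultimately show "b = \<nu> x" unfolding doubleton_eq_iff by blast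
qed (use assms(2) in blast)

text \<open>Rotating the edges of \<open>\<mu>\<close> along a directed cycle of alternating steps gives another perfect
  matching. The weight gained is the weight of the cycle as a walk, which ties walks to matchings.\<close>

lemma alternating_cycle:
  fixes w :: "'a set \<Rightarrow> 'b::ab_group_add"
  defines "M \<mu> \<equiv> (\<lambda>a. {a, \<mu> a}) ` A"
  assumes mu: "bij_betw \<mu> A B" and mu_edge: "\<And>a. a \<in> A \<Longrightarrow> {a, \<mu> a} \<in> edges G"
    and xs: "distinct xs" "2 \<le> length xs"
    and steps: "\<And>i. i < length xs \<Longrightarrow> (xs ! i, xs ! (Suc i mod length xs)) \<in> alternating_step \<mu>"
  shows "\<exists>N p. perfect_matching G N \<and> is_cycle G p \<and> sym_diff N (M \<mu>) = cycle_edges p \<and>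
    sum w N - sum w (M \<mu>) = (\<Sum>i<length xs. step_weight w \<mu> (xs ! i) (xs ! (Suc i mod length xs)))"
proof -
  define k where "k = length xs"
  have k: "2 \<le> k" using xs k_def by simp
  define nxt where "nxt i = Suc i mod k" for i
  have nxt: "nxt i < k" if "i < k" for i using that by (auto simp: nxt_def)
  have nxt_neq: "nxt i \<noteq> i" if "i < k" for i
    using that k by (cases "Suc i = k") (auto simp: nxt_def)
  have xA: "xs ! i \<in> A" if "i < k" for i
    using steps[of i] that by (auto simp: alternating_step_def k_def)
  have xs_eq: "xs ! i = xs ! j \<longleftrightarrow> i = j" if "i < k" "j < k" for i j
    using that xs by (simp add: nth_eq_iff_index_eq k_def)
  have step_edge: "{xs ! i, \<mu> (xs ! nxt i)} \<in> edges G" if "i < k" for i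
    using steps[of i] that by (auto simp: alternating_step_def k_def nxt_def)
  have muB: "\<mu> \<in> A \<rightarrow> B" and mu_inj: "inj_on \<mu> A" using mu by (auto simp: bij_betw_def)
  \<comment> \<open>moves each vertex of the cycle to its successor, so that \<open>\<mu> \<circ> \<sigma>\<close> again pairs \<open>A\<close> with \<open>B\<close>\<close>
  define \<sigma> where "\<sigma> x = (if x \<in> set xs then xs ! nxt (THE i. i < k \<and> xs ! i = x) else x)" for x
  have \<sigma>: "\<sigma> (xs ! i) = xs ! nxt i" if "i < k" for i
  proof -
    have "(THE j. j < k \<and> xs ! j = xs ! i) = i" using that xs_eq by (intro the_equality) auto
    then show ?thesis using that by (auto simp: \<sigma>_def k_def)
  qed
  have set_xs: "set xs = (!) xs ` {..<k}" by (auto simp: set_conv_nth k_def)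
  have \<sigma>_id: "\<sigma> x = x" if "x \<notin> set xs" for x using that by (simp add: \<sigma>_def)
  have \<sigma>A: "\<sigma> x \<in> A" if "x \<in> A" for x
    using that \<sigma> \<sigma>_id xA nxt by (cases "x \<in> set xs") (auto simp: set_xs)
  have surj: "A \<subseteq> \<sigma> ` A"
  proof
    fix x assume x: "x \<in> A"
    show "x \<in> \<sigma> ` A"
    proof (cases "x \<in> set xs")
      case True
      then obtain j where j: "j < k" "x = xs ! j" by (auto simp: set_xs)
      define i where "i = (if j = 0 then k - 1 else j - 1)"
      have "i < k" "nxt i = j" using j k by (auto simp: i_def nxt_def)
      then show ?thesis using \<sigma>[of i] xA[of i] j by (metis imageI)
    qed (use x \<sigma>_id in force)
  qed
  have \<sigma>_inj: "inj_on \<sigma> A" using finite_surj_inj[OF finite_parts(1) surj] .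
  have \<sigma>_bij: "bij_betw \<sigma> A A" using \<sigma>_inj surj \<sigma>A by (auto simp: bij_betw_def)
  define \<nu> where "\<nu> = \<mu> \<circ> \<sigma>"
  have nu: "bij_betw \<nu> A B" unfolding \<nu>_def by (rule bij_betw_trans[OF \<sigma>_bij mu])
  then have nuB: "\<nu> \<in> A \<rightarrow> B" by (auto simp: bij_betw_def)
  have nu_edge: "{a, \<nu> a} \<in> edges G" if "a \<in> A" for a
    using that \<sigma> \<sigma>_id step_edge mu_edge by (cases "a \<in> set xs") (auto simp: \<nu>_def set_xs)
  define N where "N = (\<lambda>a. {a, \<nu> a}) ` A"
  have PM: "perfect_matching G N" unfolding N_def by (rule matching_of_bij[OF nu nu_edge])
  have move: "\<sigma> a \<noteq> a" if "a \<in> set xs" for a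
    using that \<sigma> xs_eq nxt nxt_neq by (auto simp: set_xs)
  define E0 where "E0 = (\<lambda>i. {\<mu> (xs ! i), xs ! i}) ` {..<k}"
  define E1 where "E1 = (\<lambda>i. {xs ! i, \<mu> (xs ! nxt i)}) ` {..<k}"
  have changed: "{a, \<nu> a} \<in> M \<mu> \<longleftrightarrow> a \<notin> set xs" "{a, \<mu> a} \<in> N \<longleftrightarrow> a \<notin> set xs" if "a \<in> A" for a
  proof -
    have "\<mu> (\<sigma> a) = \<mu> a \<longleftrightarrow> \<sigma> a = a" using inj_on_eq_iff[OF mu_inj \<sigma>A[OF that] that] .
    moreover have "\<sigma> a = a \<longleftrightarrow> a \<notin> set xs" using move \<sigma>_id by blast
    ultimately have \<nu>\<mu>: "\<nu> a = \<mu> a \<longleftrightarrow> a \<notin> set xs" by (simp add: \<nu>_def)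
    have "{a, \<nu> a} \<in> M \<mu> \<longleftrightarrow> \<nu> a = \<mu> a"
      unfolding M_def by (rule pair_in_matching[OF muB that Pi_mem[OF nuB that]])
    with \<nu>\<mu> show "{a, \<nu> a} \<in> M \<mu> \<longleftrightarrow> a \<notin> set xs" by simp
    have "{a, \<mu> a} \<in> N \<longleftrightarrow> \<mu> a = \<nu> a"
      unfolding N_def by (rule pair_in_matching[OF nuB that Pi_mem[OF muB that]])
    with \<nu>\<mu> show "{a, \<mu> a} \<in> N \<longleftrightarrow> a \<notin> set xs" by (simp add: eq_commute)
  qed
  have xsA: "set xs \<subseteq> A" using xA by (auto simp: set_xs)
  have "N - M \<mu> = (\<lambda>a. {a, \<nu> a}) ` set xs" using changed xsA by (auto simp: N_def)
  also have "\<dots> = E1" unfolding set_xs E1_def image_image by (rule image_cong) (auto simp: \<nu>_def \<sigma>)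
  finally have NM: "N - M \<mu> = E1" .
  have "M \<mu> - N = (\<lambda>a. {a, \<mu> a}) ` set xs" using changed xsA by (auto simp: M_def)
  also have "\<dots> = E0" unfolding set_xs E0_def image_image by (rule image_cong) auto
  finally have MN: "M \<mu> - N = E0" .
  \<comment> \<open>the vertices of the cycle in \<open>G\<close>: each element of \<open>A\<close> is preceded by its partner in \<open>B\<close>\<close>
  define q where "q j = (if even j then \<mu> (xs ! (j div 2)) else xs ! (j div 2))" for j
  define p where "p = map q [0..<2 * k]"
  have len: "length p = 2 * k" by (simp add: p_def)
  have pq: "p ! j = q j" if "j < 2 * k" for j using that by (simp add: p_def)
  have qA: "q j \<in> A \<longleftrightarrow> odd j" "q j \<in> verts G" if "j < 2 * k" for j
  proof -
    have "xs ! (j div 2) \<in> A" using that by (intro xA) auto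
    moreover have "\<mu> (xs ! (j div 2)) \<in> B" using muB calculation by (rule Pi_mem)
    ultimately show "q j \<in> A \<longleftrightarrow> odd j" "q j \<in> verts G" using parts by (auto simp: q_def)
  qed
  have inj_q: "i = j" if ij: "i < 2 * k" "j < 2 * k" "q i = q j" for i j
  proof -
    have par: "even i \<longleftrightarrow> even j" using qA ij by metis
    have d: "i div 2 < k" "j div 2 < k" using ij by auto
    have "xs ! (i div 2) = xs ! (j div 2)"
      using ij(3) par inj_on_eq_iff[OF mu_inj xA[OF d(1)] xA[OF d(2)]]
      by (simp add: q_def split: if_splits)
    then have "i div 2 = j div 2" using xs_eq d by blast
    with par show "i = j" by (metis even_two_times_div_two odd_two_times_div_two_succ)
  qed
  have "cycle_edges p = (\<lambda>j. {q j, q (Suc j mod (2 * k))}) ` {..<2 * k}"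
    unfolding cycle_edges_image len using pq k by (intro image_cong) auto
  also have "{..<2 * k} = (\<lambda>i. 2 * i) ` {..<k} \<union> (\<lambda>i. Suc (2 * i)) ` {..<k}"
  proof (intro equalityI subsetI)
    fix j assume "j \<in> {..<2 * k}"
    then have "j div 2 < k" by auto
    moreover have "j = 2 * (j div 2) \<or> j = Suc (2 * (j div 2))" by presburger
    ultimately show "j \<in> (\<lambda>i. 2 * i) ` {..<k} \<union> (\<lambda>i. Suc (2 * i)) ` {..<k}" by blast
  qed auto
  also have "(\<lambda>j. {q j, q (Suc j mod (2 * k))}) ` \<dots> = E0 \<union> E1"
  proof -
    have "{q (2 * i), q (Suc (2 * i) mod (2 * k))} = {\<mu> (xs ! i), xs ! i}" if "i < k" for i
      using that by (simp add: q_def)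
    moreover have "{q (Suc (2 * i)), q (Suc (Suc (2 * i)) mod (2 * k))} = {xs ! i, \<mu> (xs ! nxt i)}"
      if "i < k" for i
    proof -
      have "Suc (Suc (2 * i)) mod (2 * k) = 2 * nxt i"
        unfolding nxt_def by (simp add: mult_mod_right)
      then show ?thesis by (simp add: q_def)
    qed
    ultimately show ?thesis unfolding image_Un image_image E0_def E1_def
      by (intro arg_cong2[where f = "(\<union>)"] image_cong) auto
  qed
  finally have ce: "cycle_edges p = E0 \<union> E1" .
  have "is_cycle G p"
    unfolding is_cycle_def
  proof (intro conjI)
    show "3 \<le> length p" using k len by simp
    show "distinct p" unfolding p_def by (auto simp: distinct_map inj_on_def intro: inj_q)
    show "set p \<subseteq> verts G" using qA by (auto simp: p_def)
    show "cycle_edges p \<subseteq> edges G"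
      using step_edge mu_edge xA by (auto simp: ce E0_def E1_def insert_commute)
  qed
  moreover have "sym_diff N (M \<mu>) = cycle_edges p" using NM MN ce by blast
  moreover have "sum w N - sum w (M \<mu>)
      = (\<Sum>i<length xs. step_weight w \<mu> (xs ! i) (xs ! (Suc i mod length xs)))"
  proof -
    have "sum w N = (\<Sum>a\<in>A. w {a, \<nu> a})"
      unfolding N_def by (simp add: sum.reindex[OF pair_edge_inj[OF nuB]])
    moreover have "sum w (M \<mu>) = (\<Sum>a\<in>A. w {a, \<mu> a})"
      unfolding M_def by (simp add: sum.reindex[OF pair_edge_inj[OF muB]])
    moreover have "\<dots> = (\<Sum>a\<in>A. w {\<sigma> a, \<mu> (\<sigma> a)})"
      using sum.reindex_bij_betw[OF \<sigma>_bij, of "\<lambda>a. w {a, \<mu> a}"] by simp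
    ultimately have "sum w N - sum w (M \<mu>) = (\<Sum>a\<in>A. step_weight w \<mu> a (\<sigma> a))"
      by (simp add: sum_subtractf step_weight_def \<nu>_def)
    also have "\<dots> = (\<Sum>a\<in>set xs. step_weight w \<mu> a (\<sigma> a))"
      by (rule sum.mono_neutral_right[OF finite_parts(1) xsA]) (auto simp: \<sigma>_id step_weight_def)
    also have "\<dots> = (\<Sum>i<k. step_weight w \<mu> (xs ! i) (\<sigma> (xs ! i)))"
      using sum.reindex_bij_betw[OF bij_betw_nth[OF xs(1) refl refl],
          of "\<lambda>a. step_weight w \<mu> a (\<sigma> a)"] by (simp add: k_def)
    finally show ?thesis using \<sigma> by (simp add: k_def nxt_def)
  qed
  ultimately show ?thesis using PM by blast
qed

text \<open>Along a cycle in which two matchings differ, their edges alternate. Hence, for a weight that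
  changes sign with the direction, the weight of the cycle is up to sign the difference of the
  weights of the matchings, all edges being directed from \<open>A\<close> to \<open>B\<close>.\<close>

lemma alternating_cycle_weight:
  fixes w :: "'a set \<Rightarrow> 'b::ab_group_add"
  assumes M: "perfect_matching G M" and N: "perfect_matching G N" and p: "is_cycle G p"
    and diff: "sym_diff M N = cycle_edges p"
    and w: "\<And>a b. a \<in> A \<Longrightarrow> b \<in> B \<Longrightarrow> {a, b} \<in> edges G \<Longrightarrow> w {a, b} = \<omega> a b"
    and anti: "\<And>u v. {u, v} \<in> edges G \<Longrightarrow> \<omega> v u = - \<omega> u v"
  defines "S \<equiv> \<Sum>i<length p. \<omega> (p ! i) (p ! (Suc i mod length p))"
  shows "S = sum w M - sum w N \<or> S = - (sum w M - sum w N)"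
proof -
  define k where "k = length p"
  have k: "3 \<le> k" and dist: "distinct p" and sub: "set p \<subseteq> verts G"
    and ce_sub: "cycle_edges p \<subseteq> edges G"
    using p by (auto simp: is_cycle_def k_def)
  define e where "e i = {p ! i, p ! (Suc i mod k)}" for i
  have ce: "cycle_edges p = e ` {..<k}" by (auto simp: cycle_edges_def e_def k_def)
  have edge: "e i \<in> edges G" if "i < k" for i using ce ce_sub that by auto
  have p_eq: "p ! i = p ! j \<longleftrightarrow> i = j" if "i < k" "j < k" for i j
    using that dist by (simp add: nth_eq_iff_index_eq k_def)
  have consec: "e i \<noteq> e (Suc i)" if i: "Suc i < k" for i
  proof -
    have "Suc (Suc i) mod k \<noteq> i" using i k by (cases "Suc (Suc i) = k") auto
    moreover have "Suc (Suc i) mod k < k" using k by auto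
    ultimately show ?thesis
      using i p_eq[of i "Suc i"] p_eq[of i "Suc (Suc i) mod k"] by (auto simp: e_def doubleton_eq_iff)
  qed
  have inj: "inj_on e {..<k}"
  proof (rule inj_onI)
    fix i j assume ij: "i \<in> {..<k}" "j \<in> {..<k}" "e i = e j"
    have m: "Suc i mod k < k" "Suc j mod k < k" using k by auto
    show "i = j"
    proof (rule ccontr)
      assume "i \<noteq> j"
      then have "p ! i \<noteq> p ! j" using p_eq ij by simp
      moreover have "{p ! i, p ! (Suc i mod k)} = {p ! j, p ! (Suc j mod k)}"
        using ij(3) by (simp only: e_def)
      ultimately have "p ! i = p ! (Suc j mod k)" "p ! j = p ! (Suc i mod k)"
        unfolding doubleton_eq_iff by metis+
      then have eq: "i = Suc j mod k" "j = Suc i mod k"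
        using iffD1[OF p_eq[of i "Suc j mod k"]] iffD1[OF p_eq[of j "Suc i mod k"]] ij m by blast+
      have "Suc i mod k = (if Suc i = k then 0 else Suc i)"
        "Suc j mod k = (if Suc j = k then 0 else Suc j)" using ij by auto
      then have "i = 0 \<and> Suc j = k \<or> i = Suc j" "j = 0 \<and> Suc i = k \<or> j = Suc i"
        using eq by metis+
      then show False using k by linarith
    qed
  qed
  have one: "e i \<in> M \<longleftrightarrow> e i \<notin> N" if "i < k" for i
  proof -
    have "e i \<in> sym_diff M N" unfolding diff ce using that by simp
    then show ?thesis by blast
  qed
  have flip: "e (Suc i) \<in> M \<longleftrightarrow> e i \<notin> M" if i: "Suc i < k" for i
  proof -
    have "p ! Suc i \<in> e i" "p ! Suc i \<in> e (Suc i)" using i by (auto simp: e_def)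
    then have "\<not> (e i \<in> M \<and> e (Suc i) \<in> M)" "\<not> (e i \<in> N \<and> e (Suc i) \<in> N)"
      using matching_unique[OF M, of "e i" "e (Suc i)" "p ! Suc i"]
        matching_unique[OF N, of "e i" "e (Suc i)" "p ! Suc i"] consec[OF i] by auto
    then show ?thesis using one i by auto
  qed
  have end_parts: "\<omega> (p ! i) (p ! (Suc i mod k)) = (if p ! i \<in> A then w (e i) else - w (e i)) \<and>
      (p ! (Suc i mod k) \<in> A \<longleftrightarrow> p ! i \<notin> A)" if i: "i < k" for i
  proof -
    obtain a b where ab: "a \<in> A" "b \<in> B" "e i = {a, b}" using bip[OF edge[OF i]] by blast
    then have "a \<noteq> b" using parts by blast
    then consider "p ! i = a" "p ! (Suc i mod k) = b" | "p ! i = b" "p ! (Suc i mod k) = a"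
      using ab(3) by (auto simp: e_def doubleton_eq_iff)
    then show ?thesis
    proof cases
      case 1
      then show ?thesis using ab w[of a b] edge[OF i] parts by auto
    next
      case 2
      then show ?thesis using ab w[of a b] edge[OF i] anti[of a b] parts by auto
    qed
  qed
  have phase: "(p ! i \<in> A \<longleftrightarrow> e i \<in> M) \<longleftrightarrow> (p ! 0 \<in> A \<longleftrightarrow> e 0 \<in> M)" if "i < k" for i
    using that
  proof (induction i)
    case (Suc i)
    then show ?case using flip[of i] end_parts[of i] by auto
  qed simp
  have fin_M: "finite M" "finite N" using M N finite_matching by auto
  have "sum w M - sum w N = sum w (M - N) - sum w (N - M)"
    using sum.Int_Diff[OF fin_M(1), of w N] sum.Int_Diff[OF fin_M(2), of w M]
    by (simp add: Int_commute)
  also have "\<dots> = (\<Sum>f\<in>cycle_edges p. if f \<in> M then w f else - w f)"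
  proof -
    have "(\<Sum>f\<in>cycle_edges p. if f \<in> M then w f else - w f)
        = (\<Sum>f\<in>M - N. if f \<in> M then w f else - w f) + (\<Sum>f\<in>N - M. if f \<in> M then w f else - w f)"
      unfolding diff[symmetric] using fin_M by (intro sum.union_disjoint) auto
    moreover have "(\<Sum>f\<in>M - N. if f \<in> M then w f else - w f) = sum w (M - N)"
      by (rule sum.cong) auto
    moreover have "(\<Sum>f\<in>N - M. if f \<in> M then w f else - w f) = - sum w (N - M)"
      unfolding sum_negf[symmetric] by (rule sum.cong) auto
    ultimately show ?thesis by simp
  qed
  also have "\<dots> = (\<Sum>i<k. if e i \<in> M then w (e i) else - w (e i))"
    unfolding ce by (simp add: sum.reindex[OF inj])
  finally have total: "sum w M - sum w N = (\<Sum>i<k. if e i \<in> M then w (e i) else - w (e i))" .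
  have S: "S = (\<Sum>i<k. if p ! i \<in> A then w (e i) else - w (e i))"
    unfolding S_def using end_parts by (simp add: k_def)
  show ?thesis
  proof (cases "p ! 0 \<in> A \<longleftrightarrow> e 0 \<in> M")
    case True
    then have "S = sum w M - sum w N"
      unfolding S total using phase by (intro sum.cong) auto
    then show ?thesis ..
  next
    case False
    then have "S = - (sum w M - sum w N)"
      unfolding S total sum_negf[symmetric] using phase by (intro sum.cong) auto
    then show ?thesis ..
  qed
qed

end

locale elementary_bipartition = bipartition +
  assumes elem: "elementary_graph G"
begin

lemma Union_allowed_edges: "\<Union>(allowed_edges G) = verts G"
proof (intro equalityI subsetI)
  fix v assume "v \<in> \<Union>(allowed_edges G)"
  then show "v \<in> verts G" using matching_edges edge_subset_verts by (auto simp: allowed_edges_def)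
next
  fix v assume "v \<in> verts G"
  moreover obtain M where "perfect_matching G M" using elem by (auto simp: elementary_graph_def)
  ultimately show "v \<in> \<Union>(allowed_edges G)"
    using matching_covers by (fastforce simp: allowed_edges_def)
qed

lemma verts_nonempty: "verts G \<noteq> {}"
  using elem by (auto simp: elementary_graph_def connected_graph_def Union_allowed_edges)

lemma vertex_on_edge:
  assumes "v \<in> verts G"
  obtains e where "e \<in> edges G" "v \<in> e"
proof -
  obtain M where M: "perfect_matching G M" using elem by (auto simp: elementary_graph_def)
  then show thesis using matching_covers[OF M assms] matching_edges[OF M] that by blast
qed

lemma allowed_edge_connected:
  assumes "u \<in> verts G" "v \<in> verts G" "P u"
    and "\<And>x y. {x, y} \<in> allowed_edges G \<Longrightarrow> P x \<Longrightarrow> P y"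
  shows "P v"
proof -
  have "(u, v) \<in> {(x, y). {x, y} \<in> allowed_edges G}\<^sup>*"
    using elem assms(1,2) by (auto simp: elementary_graph_def connected_graph_def Union_allowed_edges)
  then show ?thesis by (induction rule: rtrancl_induct) (use assms in auto)
qed

lemma edge_connected:
  assumes "u \<in> verts G" "v \<in> verts G" "P u"
    and "\<And>x y. {x, y} \<in> edges G \<Longrightarrow> P x \<Longrightarrow> P y"
  shows "P v"
proof (rule allowed_edge_connected[of u v P])
  fix x y assume "{x, y} \<in> allowed_edges G" "P x"
  then show "P y" using matching_edges assms(4) unfolding allowed_edges_def by blast
qed (use assms in auto)

text \<open>Comparing a perfect matching through an edge with \<open>\<mu>\<close> gives a permutation of \<open>A\<close> whose
  orbits are walks; so the ends of an allowed edge reach each other, and connectedness by allowed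
  edges becomes strong connectedness.\<close>

lemma alternating_strongly_connected:
  assumes mu: "bij_betw \<mu> A B" and mu_edge: "\<And>a. a \<in> A \<Longrightarrow> {a, \<mu> a} \<in> edges G"
    and xy: "x \<in> A" "y \<in> A"
  shows "(x, y) \<in> (alternating_step \<mu>)\<^sup>*"
proof -
  let ?R = "(alternating_step \<mu>)\<^sup>*"
  define rep where "rep v = (if v \<in> A then v else the_inv_into A \<mu> v)" for v
  have inj: "inj_on \<mu> A" and im: "\<mu> ` A = B" using mu by (auto simp: bij_betw_def)
  have repA: "rep a = a" if "a \<in> A" for a using that by (simp add: rep_def)
  have repB: "rep (\<mu> a) = a" if "a \<in> A" for a
    using that im parts by (auto simp: rep_def the_inv_into_f_f[OF inj])
  have allowed: "(rep u, rep v) \<in> ?R" if uv: "{u, v} \<in> allowed_edges G" for u v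
  proof -
    obtain M where M: "perfect_matching G M" "{u, v} \<in> M" using uv by (auto simp: allowed_edges_def)
    obtain \<nu> where nu: "bij_betw \<nu> A B" "M = (\<lambda>a. {a, \<nu> a}) ` A" using matching_bij[OF M(1)] .
    define \<sigma> where "\<sigma> = rep \<circ> \<nu>"
    have nu_mu: "\<mu> (\<sigma> a) = \<nu> a" "\<sigma> a \<in> A" if a: "a \<in> A" for a
    proof -
      have "\<nu> a \<in> \<mu> ` A" using nu im a by (auto simp: bij_betw_def)
      then obtain c where "c \<in> A" "\<nu> a = \<mu> c" by blast
      then show "\<mu> (\<sigma> a) = \<nu> a" "\<sigma> a \<in> A" using repB by (auto simp: \<sigma>_def)
    qed
    have inj\<sigma>: "inj_on \<sigma> A"
      using nu nu_mu by (metis (no_types, lifting) bij_betw_def inj_on_def)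
    have step: "(a, \<sigma> a) \<in> alternating_step \<mu>" if "a \<in> A" for a
      using that nu_mu nu(2) matching_edges[OF M(1)] by (auto simp: alternating_step_def)
    have return: "(\<sigma> a, a) \<in> ?R" if a: "a \<in> A" for a
    proof -
      define S where "S = {s \<in> A. (\<sigma> a, s) \<in> ?R}"
      have "finite S" using finite_parts by (simp add: S_def)
      moreover have "\<sigma> ` S \<subseteq> S" using step nu_mu by (auto simp: S_def intro: rtrancl_into_rtrancl)
      moreover have "inj_on \<sigma> S" using inj\<sigma> by (auto simp: S_def inj_on_def)
      ultimately have "\<sigma> ` S = S" by (simp add: endo_inj_surj)
      moreover have "\<sigma> a \<in> S" using nu_mu a by (simp add: S_def)
      ultimately obtain s where "s \<in> S" "\<sigma> s = \<sigma> a" by (metis imageE)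
      then have "a \<in> S" using inj\<sigma> a by (auto simp: S_def dest: inj_onD)
      then show ?thesis by (simp add: S_def)
    qed
    obtain a where a: "a \<in> A" "{u, v} = {a, \<nu> a}" using M(2) nu(2) by auto
    have "rep a = a" "rep (\<nu> a) = \<sigma> a" using a repA by (auto simp: \<sigma>_def)
    then show ?thesis using a step[of a] return[of a] by (auto simp: doubleton_eq_iff)
  qed
  have "(x, y) \<in> {(u, v). {u, v} \<in> allowed_edges G}\<^sup>*"
    using elem xy parts(1) by (auto simp: elementary_graph_def connected_graph_def Union_allowed_edges)
  then have "(rep x, rep y) \<in> ?R"
    by (induction rule: rtrancl_induct) (auto intro: allowed rtrancl_trans)
  then show ?thesis using repA xy by simp
qed

text \<open>Two matchings that differ by one alternating cycle have the same weight exactly if the steps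
  around this cycle have total weight 0. So all closed walks of alternating steps have weight 0, and
  strong connectedness yields a potential on \<open>A\<close>; the edges of \<open>M\<close> carry it over to \<open>B\<close>. In other
  words, the alternating cycles of \<open>M\<close> generate the cycle space of \<open>G\<close>.\<close>

theorem potential_of_matching_invariant:
  fixes w :: "'a set \<Rightarrow> 'b::ab_group_add"
  assumes M: "perfect_matching G M"
    and inv: "\<And>N p. perfect_matching G N \<Longrightarrow> is_cycle G p \<Longrightarrow> sym_diff N M = cycle_edges p \<Longrightarrow>
      sum w N = sum w M"
  obtains \<pi> where "\<And>a b. a \<in> A \<Longrightarrow> b \<in> B \<Longrightarrow> {a, b} \<in> edges G \<Longrightarrow> w {a, b} = \<pi> b - \<pi> a"
proof -
  obtain \<mu> where mu: "bij_betw \<mu> A B" and M_eq: "M = (\<lambda>a. {a, \<mu> a}) ` A"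
    using matching_bij[OF M] .
  have mu_edge: "{a, \<mu> a} \<in> edges G" if "a \<in> A" for a
    using that M_eq matching_edges[OF M] by blast
  have "walk_weight (step_weight w \<mu>) (xs @ [hd xs]) = 0"
    if xs: "distinct xs" "xs \<noteq> []"
      and walk: "successively (\<lambda>u v. (u, v) \<in> alternating_step \<mu>) (xs @ [hd xs])" for xs
  proof (cases "length xs = 1")
    case True
    then obtain x where "xs = [x]" by (cases xs) auto
    then show ?thesis by (simp add: step_weight_def)
  next
    case False
    then have k: "2 \<le> length xs" using xs(2) by (cases xs; cases "tl xs") auto
    have "(xs ! i, xs ! (Suc i mod length xs)) \<in> alternating_step \<mu>" if i: "i < length xs" for i
    proof -
      have "((xs @ [hd xs]) ! i, (xs @ [hd xs]) ! Suc i) \<in> alternating_step \<mu>"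
        using successively_nth[OF walk, of i] i by simp
      then show ?thesis
        using i xs(2) by (cases "Suc i = length xs") (auto simp: nth_append hd_conv_nth)
    qed
    from alternating_cycle[OF mu mu_edge xs(1) k this, where w = w] inv
    show ?thesis unfolding walk_weight_closed M_eq[symmetric] by (metis diff_self)
  qed
  moreover have "alternating_step \<mu> \<subseteq> A \<times> A" by (auto simp: alternating_step_def)
  ultimately obtain \<pi> where pi: "\<And>x y. (x, y) \<in> alternating_step \<mu> \<Longrightarrow>
      step_weight w \<mu> x y = \<pi> y - \<pi> x"
    using potential_of_closed_walks[of "alternating_step \<mu>" "step_weight w \<mu>" A]
      alternating_strongly_connected[OF mu mu_edge] by metis
  define \<rho> where "\<rho> v = (if v \<in> A then \<pi> v
      else let a = the_inv_into A \<mu> v in \<pi> a + w {a, \<mu> a})" for v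
  show thesis
  proof (rule that[of \<rho>])
    fix a b assume ab: "a \<in> A" "b \<in> B" "{a, b} \<in> edges G"
    then obtain c where c: "c \<in> A" "b = \<mu> c" using mu by (auto simp: bij_betw_def)
    have "the_inv_into A \<mu> b = c" using c mu by (auto simp: bij_betw_def the_inv_into_f_f)
    moreover have "b \<notin> A" using ab parts by blast
    moreover have "(a, c) \<in> alternating_step \<mu>" using ab c by (simp add: alternating_step_def)
    ultimately show "w {a, b} = \<rho> b - \<rho> a"
      using pi[of a c] ab c by (simp add: \<rho>_def step_weight_def algebra_simps)
  qed
qed

end


section \<open>Cycles of a plane graph as Jordan curves\<close>

locale plane =
  fixes G :: "complex ugraph" and \<gamma> :: "complex set \<Rightarrow> real \<Rightarrow> complex"
  assumes plane: "plane_graph G \<gamma>"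
begin

abbreviation curve :: "complex set \<Rightarrow> complex set" where
  "curve e \<equiv> path_image (\<gamma> e)"

abbreviation D :: "complex set" where
  "D \<equiv> drawing G \<gamma>"

text \<open>The arc that draws the edge \<open>{u, v}\<close> may be parametrised from \<open>v\<close> to \<open>u\<close>, so it is reversed
  where necessary.\<close>

definition directed :: "complex \<Rightarrow> complex \<Rightarrow> real \<Rightarrow> complex" where
  "directed u v = (if pathstart (\<gamma> {u, v}) = u then \<gamma> {u, v} else reversepath (\<gamma> {u, v}))"

definition turn :: "complex \<Rightarrow> complex \<Rightarrow> complex \<Rightarrow> complex" where
  "turn z u v = winding_number (directed u v) z"

lemma edge_arc:
  assumes "e \<in> edges G"
  shows "arc (\<gamma> e)" "{pathstart (\<gamma> e), pathfinish (\<gamma> e)} = e" "curve e \<inter> verts G = e"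
  using plane assms by (auto simp: plane_graph_def)

lemma curve_Int: "e \<in> edges G \<Longrightarrow> f \<in> edges G \<Longrightarrow> e \<noteq> f \<Longrightarrow> curve e \<inter> curve f = e \<inter> f"
  using plane by (auto simp: plane_graph_def)

lemma edge_subset_curve: "e \<in> edges G \<Longrightarrow> e \<subseteq> curve e"
  using edge_arc(3) by blast

lemma curve_subset_D: "e \<in> edges G \<Longrightarrow> curve e \<subseteq> D"
  by (auto simp: drawing_def)

lemma infinite_curve:
  assumes "e \<in> edges G"
  shows "infinite (curve e)"
proof -
  have "inj_on (\<gamma> e) {0..1}" using edge_arc(1)[OF assms] by (simp add: arc_def)
  then show ?thesis unfolding path_image_def by (simp add: finite_image_iff)
qed

lemma finite_graph: "finite (verts G)" "finite (edges G)"
proof -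
  show v: "finite (verts G)" using plane by (auto simp: plane_graph_def fin_graph_def)
  have "edges G \<subseteq> Pow (verts G)"
    using plane by (fastforce simp: plane_graph_def fin_graph_def)
  then show "finite (edges G)" using v by (meson finite_Pow_iff finite_subset)
qed

lemma compact_curves: "compact (verts G)" "S \<subseteq> edges G \<Longrightarrow> compact (\<Union>e\<in>S. curve e)"
proof -
  show "compact (verts G)" using finite_graph(1) by (rule finite_imp_compact)
  assume S: "S \<subseteq> edges G"
  show "compact (\<Union>e\<in>S. curve e)"
  proof (rule compact_UN)
    show "finite S" using S finite_graph(2) by (rule finite_subset)
    show "compact (curve e)" if "e \<in> S" for e
      using that S by (intro compact_path_image arc_imp_path edge_arc(1)) blast
  qed
qed

lemma compact_D: "compact D"
  unfolding drawing_def by (intro compact_Un compact_curves subset_refl)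

lemma open_Compl_D: "open (- D)"
  using compact_D by (simp add: compact_imp_closed open_Compl)

lemma directed:
  assumes "{u, v} \<in> edges G"
  shows "arc (directed u v)" "pathstart (directed u v) = u" "pathfinish (directed u v) = v"
    "path_image (directed u v) = curve {u, v}"
proof -
  note e = edge_arc[OF assms]
  have ne: "pathstart (\<gamma> {u, v}) \<noteq> pathfinish (\<gamma> {u, v})" using arc_distinct_ends[OF e(1)] by metis
  show "arc (directed u v)" using e(1) by (simp add: directed_def arc_reversepath)
  show "pathstart (directed u v) = u" "pathfinish (directed u v) = v"
    using e(2) ne by (auto simp: directed_def doubleton_eq_iff)
  show "path_image (directed u v) = curve {u, v}" by (simp add: directed_def)
qed

lemma turn_reverse:
  assumes "{u, v} \<in> edges G" "z \<notin> D"
  shows "turn z v u = - turn z u v"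
proof -
  note e = edge_arc[OF assms(1)]
  have ne: "pathstart (\<gamma> {u, v}) \<noteq> pathfinish (\<gamma> {u, v})" using arc_distinct_ends[OF e(1)] by metis
  have "z \<notin> curve {u, v}" using assms curve_subset_D by blast
  moreover have "path (\<gamma> {u, v})" using e(1) by (rule arc_imp_path)
  ultimately have rev: "winding_number (reversepath (\<gamma> {u, v})) z = - winding_number (\<gamma> {u, v}) z"
    by (simp add: winding_number_reversepath)
  have vu: "directed v u = (if pathstart (\<gamma> {u, v}) = v then \<gamma> {u, v} else reversepath (\<gamma> {u, v}))"
    unfolding directed_def insert_commute[of v u] ..
  consider "pathstart (\<gamma> {u, v}) = u" "u \<noteq> v" | "pathstart (\<gamma> {u, v}) = v" "u \<noteq> v"
    using e(2) ne by (auto simp: doubleton_eq_iff)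
  then show ?thesis unfolding turn_def vu directed_def[of u v] by cases (simp_all add: rev)
qed

lemma vertex_path_arc:
  assumes "1 \<le> n" "inj_on v {..n}" "\<And>i. i < n \<Longrightarrow> {v i, v (Suc i)} \<in> edges G"
  shows "\<exists>g. arc g \<and> pathstart g = v 0 \<and> pathfinish g = v n \<and>
    path_image g = (\<Union>i<n. curve {v i, v (Suc i)}) \<and>
    (\<forall>z. z \<notin> D \<longrightarrow> winding_number g z = (\<Sum>i<n. turn z (v i) (v (Suc i))))"
  using assms
proof (induction n rule: nat_induct_at_least)
  case base
  then show ?case
    using directed[of "v 0" "v 1"] by (intro exI[of _ "directed (v 0) (v 1)"]) (auto simp: turn_def)
next
  case (Suc n)
  obtain g where g: "arc g" "pathstart g = v 0" "pathfinish g = v n"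
    "path_image g = (\<Union>i<n. curve {v i, v (Suc i)})"
    "\<And>z. z \<notin> D \<Longrightarrow> winding_number g z = (\<Sum>i<n. turn z (v i) (v (Suc i)))"
    using Suc.IH Suc.prems by (auto simp: inj_on_def)
  have e: "{v n, v (Suc n)} \<in> edges G" using Suc.prems by simp
  note d = directed[OF e]
  have "path_image g \<inter> curve {v n, v (Suc n)} \<subseteq> {v n}"
  proof
    fix x assume x: "x \<in> path_image g \<inter> curve {v n, v (Suc n)}"
    then obtain i where i: "i < n" "x \<in> curve {v i, v (Suc i)}" using g(4) by blast
    have ne: "v (Suc n) \<noteq> v i" "v (Suc n) \<noteq> v (Suc i)"
      using i inj_on_eq_iff[OF Suc.prems(1), of "Suc n"] by auto
    then have "{v i, v (Suc i)} \<noteq> {v n, v (Suc n)}" by blast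
    then have "x \<in> {v i, v (Suc i)} \<inter> {v n, v (Suc n)}"
      using curve_Int[OF Suc.prems(2)[of i] e] i x by auto
    then show "x \<in> {v n}" using ne by auto
  qed
  then have arc: "arc (g +++ directed (v n) (v (Suc n)))"
    using g d by (intro arc_join) auto
  show ?case
  proof (intro exI conjI allI impI)
    show "arc (g +++ directed (v n) (v (Suc n)))" by (fact arc)
    show "path_image (g +++ directed (v n) (v (Suc n))) = (\<Union>i<Suc n. curve {v i, v (Suc i)})"
      using g d by (subst path_image_join) (auto simp: lessThan_Suc)
    fix z assume z: "z \<notin> D"
    have "path_image g \<subseteq> D"
      unfolding g(4) by (intro UN_least curve_subset_D Suc.prems(2)) simp
    moreover have "path_image (directed (v n) (v (Suc n))) \<subseteq> D"
      unfolding d(4) by (rule curve_subset_D[OF e])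
    ultimately have "z \<notin> path_image g" "z \<notin> path_image (directed (v n) (v (Suc n)))"
      using z by blast+
    then have "winding_number (g +++ directed (v n) (v (Suc n))) z
        = winding_number g z + winding_number (directed (v n) (v (Suc n))) z"
      using g d by (intro winding_number_join) (auto intro: arc_imp_path)
    then show "winding_number (g +++ directed (v n) (v (Suc n))) z
        = (\<Sum>i<Suc n. turn z (v i) (v (Suc i)))"
      using g(5)[OF z] by (simp add: turn_def)
  qed (use g d in auto)
qed

lemma cycle_facts:
  assumes "is_cycle G p"
  shows "3 \<le> length p" "\<And>i j. i < length p \<Longrightarrow> j < length p \<Longrightarrow> p ! i = p ! j \<longleftrightarrow> i = j"
    "\<And>i. i < length p \<Longrightarrow> {p ! i, p ! (Suc i mod length p)} \<in> edges G"
    "cycle_edges p \<subseteq> edges G"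
  using assms by (auto simp: is_cycle_def nth_eq_iff_index_eq cycle_edges_image)

text \<open>This is what makes sums of turns along a cycle accessible: they are the winding numbers of a
  Jordan curve.\<close>

lemma cycle_curve:
  assumes p: "is_cycle G p"
  obtains g where "simple_path g" "pathfinish g = pathstart g"
    "path_image g = (\<Union>e\<in>cycle_edges p. curve e)"
    "\<And>z. z \<notin> D \<Longrightarrow>
      winding_number g z = (\<Sum>i<length p. turn z (p ! i) (p ! (Suc i mod length p)))"
proof -
  note c = cycle_facts[OF p]
  obtain n where n: "length p = Suc n" "2 \<le> n" using c(1) by (cases "length p") auto
  have step: "{p ! i, p ! Suc i} \<in> edges G" if "i < n" for i
    using c(3)[of i] that n by simp
  have close: "{p ! n, p ! 0} \<in> edges G" using c(3)[of n] n by simp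
  obtain g where g: "arc g" "pathstart g = p ! 0" "pathfinish g = p ! n"
    "path_image g = (\<Union>i<n. curve {p ! i, p ! Suc i})"
    "\<And>z. z \<notin> D \<Longrightarrow> winding_number g z = (\<Sum>i<n. turn z (p ! i) (p ! Suc i))"
    using vertex_path_arc[of n "(!) p"] step n c(2) by (auto simp: inj_on_def)
  note d = directed[OF close]
  have int: "path_image g \<inter> curve {p ! n, p ! 0} \<subseteq> {p ! 0, p ! n}"
  proof
    fix x assume x: "x \<in> path_image g \<inter> curve {p ! n, p ! 0}"
    then obtain i where i: "i < n" "x \<in> curve {p ! i, p ! Suc i}" using g(4) by blast
    have "{p ! i, p ! Suc i} \<noteq> {p ! n, p ! 0}"
      using i n c(2)[of i n] c(2)[of "Suc i" 0] c(2)[of i 0] c(2)[of "Suc i" n]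
      by (auto simp: doubleton_eq_iff)
    then show "x \<in> {p ! 0, p ! n}"
      using curve_Int[OF step close] i x by auto
  qed
  show thesis
  proof (rule that[of "g +++ directed (p ! n) (p ! 0)"])
    show "simple_path (g +++ directed (p ! n) (p ! 0))"
      using g d int by (intro simple_path_join_loop) auto
    show "path_image (g +++ directed (p ! n) (p ! 0)) = (\<Union>e\<in>cycle_edges p. curve e)"
      using g d n by (subst path_image_join) (auto simp: cycle_edges_image lessThan_Suc)
    fix z assume z: "z \<notin> D"
    have "path_image g \<subseteq> D"
      unfolding g(4) by (intro UN_least curve_subset_D step) simp
    moreover have "path_image (directed (p ! n) (p ! 0)) \<subseteq> D"
      unfolding d(4) by (rule curve_subset_D[OF close])
    ultimately have "z \<notin> path_image g" "z \<notin> path_image (directed (p ! n) (p ! 0))"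
      using z by blast+
    then have "winding_number (g +++ directed (p ! n) (p ! 0)) z
        = winding_number g z + winding_number (directed (p ! n) (p ! 0)) z"
      using g d by (intro winding_number_join) (auto intro: arc_imp_path)
    then show "winding_number (g +++ directed (p ! n) (p ! 0)) z
        = (\<Sum>i<length p. turn z (p ! i) (p ! (Suc i mod length p)))"
      using g(5)[OF z] by (simp add: turn_def n)
  qed (use g d in auto)
qed

lemma mod_shift_inject:
  assumes "i < k" "j < k" "(m + i) mod k = (m + j) mod (k :: nat)"
  shows "i = j"
proof -
  have *: "i = j" if "i \<le> j" "j < k" "(m + j) mod k = (m + i) mod k" for i j
  proof -
    have "k dvd j - i" using that mod_eq_dvd_iff_nat[of "m + i" "m + j" k] by simp
    with that show "i = j" using nat_dvd_not_less[of "j - i" k] by force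
  qed
  then show ?thesis using assms by (cases "i \<le> j") (force, metis nat_le_linear)
qed

text \<open>Removing an edge from a cycle leaves a path between its ends. The connectedness of this path is
  what Janiszewski's theorem will ask for.\<close>

lemma connected_cycle_minus_edge:
  assumes p: "is_cycle G p" and e: "e \<in> cycle_edges p"
  shows "connected (\<Union>f\<in>cycle_edges p - {e}. curve f)" "e \<subseteq> (\<Union>f\<in>cycle_edges p - {e}. curve f)"
proof -
  note c = cycle_facts[OF p]
  define k where "k = length p"
  have k: "3 \<le> k" using c k_def by simp
  obtain m where m: "m < k" "e = {p ! m, p ! (Suc m mod k)}"
    using e by (auto simp: cycle_edges_image k_def)
  \<comment> \<open>the vertices of the cycle, beginning just behind the removed edge\<close>
  define v where "v i = p ! ((Suc m + i) mod k)" for i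
  have vS: "v (Suc i) = p ! (Suc ((Suc m + i) mod k) mod k)" for i
    by (simp add: v_def mod_Suc_eq)
  have v_edge: "{v i, v (Suc i)} \<in> cycle_edges p" for i
    unfolding vS v_def[of i] cycle_edges_image k_def[symmetric]
    by (rule image_eqI[of _ _ "(Suc m + i) mod k"]) (use k in simp_all)
  have inj: "inj_on v {..k - 1}"
  proof (rule inj_onI)
    fix i j assume ij: "i \<in> {..k - 1}" "j \<in> {..k - 1}" "v i = v j"
    have "(Suc m + i) mod k < length p" "(Suc m + j) mod k < length p"
      unfolding k_def[symmetric] using k by (simp_all add: mod_less_divisor)
    from c(2)[OF this] ij(3) have "(Suc m + i) mod k = (Suc m + j) mod k" unfolding v_def ..
    then show "i = j" using mod_shift_inject[of i k j "Suc m"] ij k by simp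
  qed
  have "1 \<le> k - 1" using k by simp
  moreover have "{v i, v (Suc i)} \<in> edges G" for i using v_edge c(4) by blast
  ultimately obtain g where g: "arc g" "pathstart g = v 0" "pathfinish g = v (k - 1)"
      "path_image g = (\<Union>i<k - 1. curve {v i, v (Suc i)})"
    using vertex_path_arc[OF _ inj] by metis
  have ends: "v 0 = p ! (Suc m mod k)" "v (k - 1) = p ! m"
    using m k by (auto simp: v_def)
  have others: "(\<lambda>i. {v i, v (Suc i)}) ` {..<k - 1} = cycle_edges p - {e}"
  proof (intro equalityI subsetI)
    fix f assume "f \<in> (\<lambda>i. {v i, v (Suc i)}) ` {..<k - 1}"
    then obtain i where i: "i < k - 1" "f = {v i, v (Suc i)}" by blast
    have "v i = v (k - 1) \<longleftrightarrow> i = k - 1"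
      by (rule inj_on_eq_iff[OF inj]) (use i(1) in simp_all)
    then have n1: "v i \<noteq> v (k - 1)" using i(1) by simp
    have "v (Suc i) = v (k - 1) \<longleftrightarrow> Suc i = k - 1"
      by (rule inj_on_eq_iff[OF inj]) (use i(1) in simp_all)
    moreover have "v i = v 0 \<longleftrightarrow> i = 0"
      by (rule inj_on_eq_iff[OF inj]) (use i(1) in simp_all)
    moreover have "\<not> (Suc i = k - 1 \<and> i = 0)" using k by linarith
    ultimately have n2: "v (Suc i) \<noteq> v (k - 1) \<or> v i \<noteq> v 0" by blast
    have "{v i, v (Suc i)} \<noteq> {v (k - 1), v 0}"
    proof
      assume "{v i, v (Suc i)} = {v (k - 1), v 0}"
      then show False using n1 n2 unfolding doubleton_eq_iff by (elim disjE conjE) simp_all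
    qed
    moreover have "e = {v (k - 1), v 0}" using m(2) ends by simp
    ultimately have "f \<noteq> e" using i(2) by simp
    then show "f \<in> cycle_edges p - {e}" using i v_edge by blast
  next
    fix f assume f: "f \<in> cycle_edges p - {e}"
    then obtain j where j: "j < k" "f = {p ! j, p ! (Suc j mod k)}"
      by (auto simp: cycle_edges_image k_def)
    then have "j \<noteq> m" using f m by blast
    define i where "i = (if m < j then j - Suc m else j + k - Suc m)"
    have "i < k - 1" "Suc m + i = (if m < j then j else j + k)"
      using j(1) m(1) k \<open>j \<noteq> m\<close> by (auto simp: i_def)
    then have "i < k - 1" "(Suc m + i) mod k = j" using j(1) by simp_all
    then have "f = {v i, v (Suc i)}" unfolding j(2) vS v_def[of i] by simp
    with \<open>i < k - 1\<close> show "f \<in> (\<lambda>i. {v i, v (Suc i)}) ` {..<k - 1}" by blast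
  qed
  have img: "path_image g = (\<Union>f\<in>cycle_edges p - {e}. curve f)"
    unfolding g(4) others[symmetric] by simp
  show "connected (\<Union>f\<in>cycle_edges p - {e}. curve f)"
    unfolding img[symmetric] using g(1) by (intro connected_path_image arc_imp_path)
  have "e \<subseteq> path_image g"
    unfolding m(2)
    using pathstart_in_path_image[of g] pathfinish_in_path_image[of g] g(2,3) ends by simp
  then show "e \<subseteq> (\<Union>f\<in>cycle_edges p - {e}. curve f)" unfolding img .
qed

end


section \<open>Faces bounded by a cycle\<close>

context plane
begin

lemma finite_face:
  assumes "F \<in> finite_faces G \<gamma>"
  shows "open F" "connected F" "bounded F" "F \<noteq> {}" "F \<inter> D = {}" "F \<in> components (- D)"
proof -
  show F: "F \<in> components (- D)" and "bounded F" using assms by (auto simp: finite_faces_def)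
  show "open F" using open_components[OF open_Compl_D F] .
  show "connected F" using in_components_connected[OF F] .
  show "F \<noteq> {}" using in_components_nonempty[OF F] .
  show "F \<inter> D = {}" using in_components_subset[OF F] by blast
qed

text \<open>The finite face whose boundary is a Jordan curve is the inside of that curve: inside and
  outside are connected and miss the boundary of the face.\<close>

lemma face_eq_inside:
  assumes F: "F \<in> finite_faces G \<gamma>" and g: "simple_path g" "pathfinish g = pathstart g"
    and fr: "frontier F = path_image g"
  shows "F = inside (path_image g)"
proof -
  note f = finite_face[OF F]
  note J = Jordan_inside_outside[OF g]
  have disj: "F \<inter> path_image g = {}"
    using f(1) fr by (metis Int_commute frontier_disjoint_eq)
  have "\<not> outside (path_image g) \<subseteq> F" using J f(3) bounded_subset by blast
  moreover have "outside (path_image g) \<inter> frontier F = {}" unfolding fr using J by auto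
  ultimately have "outside (path_image g) \<inter> F = {}"
    using connected_Int_frontier[of "outside (path_image g)" F] J by blast
  then have sub: "F \<subseteq> inside (path_image g)" using J disj by blast
  moreover have "inside (path_image g) \<inter> frontier F = {}" unfolding fr using J by auto
  ultimately have "inside (path_image g) \<subseteq> F"
    using connected_Int_frontier[of "inside (path_image g)" F] J f(4) by blast
  with sub show ?thesis by blast
qed

lemma periphery_curve:
  assumes F: "F \<in> finite_faces G \<gamma>" and p: "is_periphery G \<gamma> p F"
  obtains g where "simple_path g" "pathfinish g = pathstart g"
    "path_image g = (\<Union>e\<in>cycle_edges p. curve e)" "F = inside (path_image g)"
    "\<And>z. z \<notin> D \<Longrightarrow>
      winding_number g z = (\<Sum>i<length p. turn z (p ! i) (p ! (Suc i mod length p)))"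
proof -
  have c: "is_cycle G p" and fr: "frontier F = (\<Union>e\<in>cycle_edges p. curve e)"
    using p by (auto simp: is_periphery_def)
  obtain g where g: "simple_path g" "pathfinish g = pathstart g"
    "path_image g = (\<Union>e\<in>cycle_edges p. curve e)"
    "\<And>z. z \<notin> D \<Longrightarrow>
      winding_number g z = (\<Sum>i<length p. turn z (p ! i) (p ! (Suc i mod length p)))"
    using that by (rule cycle_curve[OF c])
  show thesis
    by (rule that[OF g(1-3) _ g(4)]) (use face_eq_inside[OF F g(1,2)] fr g(3) in auto)
qed

text \<open>For a face whose periphery is a cycle these are the edges of the cycle. Unlike the cycle, given
  as a list, this set is determined by the face.\<close>

definition boundary :: "complex set \<Rightarrow> complex set set" where
  "boundary F = {e \<in> edges G. curve e \<subseteq> frontier F}"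

lemma periphery_boundary:
  assumes "is_periphery G \<gamma> p F"
  shows "boundary F = cycle_edges p"
proof (intro equalityI subsetI)
  have c: "is_cycle G p" and fr: "frontier F = (\<Union>e\<in>cycle_edges p. curve e)"
    using assms by (auto simp: is_periphery_def)
  note cf = cycle_facts(4)[OF c]
  show "e \<in> boundary F" if "e \<in> cycle_edges p" for e
    using that cf fr by (auto simp: boundary_def)
  fix e assume "e \<in> boundary F"
  then have e: "e \<in> edges G" "curve e \<subseteq> frontier F" by (auto simp: boundary_def)
  show "e \<in> cycle_edges p"
  proof (rule ccontr)
    assume no: "e \<notin> cycle_edges p"
    have "curve e \<subseteq> e"
    proof
      fix x assume x: "x \<in> curve e"
      then obtain f where f: "f \<in> cycle_edges p" "x \<in> curve f" using e fr by blast
      with no have "e \<noteq> f" by blast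
      then show "x \<in> e" using curve_Int[OF e(1), of f] f cf x by blast
    qed
    moreover have "finite e" using edge_arc(2)[OF e(1)] by (metis finite.emptyI finite.insertI)
    ultimately show False
      using infinite_curve[OF e(1)] finite_subset by blast
  qed
qed

lemma boundary_inject:
  assumes "F \<in> finite_faces G \<gamma>" "is_periphery G \<gamma> p F"
    and "F' \<in> finite_faces G \<gamma>" "is_periphery G \<gamma> p' F'"
    and "boundary F = boundary F'"
  shows "F = F'"
proof -
  obtain g where g: "simple_path g" "pathfinish g = pathstart g"
    "path_image g = (\<Union>e\<in>cycle_edges p. curve e)" "F = inside (path_image g)"
    using periphery_curve[OF assms(1,2)] by metis
  have "cycle_edges p = cycle_edges p'"
    using assms periphery_boundary by metis
  then have "frontier F' = path_image g"
    using assms(4) g(3) by (simp add: is_periphery_def)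
  then show ?thesis using face_eq_inside[OF assms(3) g(1,2)] g(4) by simp
qed

text \<open>Cut out of the drawing a short piece of the edge;
  near its midpoint the rest \<open>R\<close> of the drawing does not separate. Two nearby points outside the
  cycle bounding the first face are not separated by this cycle either, and the cycle meets \<open>R\<close>
  in a connected set; so by Janiszewski's theorem the whole drawing does not separate them.\<close>

lemma edge_on_two_faces:
  assumes F: "F \<in> finite_faces G \<gamma>" "is_periphery G \<gamma> p F" "e \<in> boundary F"
    and X: "X \<in> finite_faces G \<gamma>" "e \<in> boundary X" "X \<noteq> F"
    and Y: "Y \<in> finite_faces G \<gamma>" "e \<in> boundary Y" "Y \<noteq> F"
  shows "X = Y"
proof -
  obtain g where g: "simple_path g" "pathfinish g = pathstart g"
    "path_image g = (\<Union>e\<in>cycle_edges p. curve e)" "F = inside (path_image g)"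
    using periphery_curve[OF F(1,2)] by metis
  have c: "is_cycle G p" using F(2) by (simp add: is_periphery_def)
  have ep: "e \<in> cycle_edges p" and eG: "e \<in> edges G"
    using F(3) periphery_boundary[OF F(2)] by (auto simp: boundary_def)
  note cG = cycle_facts(4)[OF c]
  note ea = edge_arc[OF eG]
  have cont: "continuous_on {0..1} (\<gamma> e)" and inj: "inj_on (\<gamma> e) {0..1}"
    using ea(1) by (auto simp: arc_def path_def)
  define mid where "mid = \<gamma> e ` {1/4<..<3/4}"
  define tails where "tails = \<gamma> e ` {0..1/4} \<union> \<gamma> e ` {3/4..1}"
  have curve_split: "curve e = mid \<union> tails"
  proof -
    have "{0..1::real} = {1/4<..<3/4} \<union> ({0..1/4} \<union> {3/4..1})" by auto
    then show ?thesis unfolding path_image_def mid_def tails_def by (metis image_Un)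
  qed
  have mid_tails: "mid \<inter> tails = {}"
    using inj unfolding mid_def tails_def by (auto dest!: inj_onD)
  have e_ends: "e = {\<gamma> e 0, \<gamma> e 1}" using ea(2) by (simp add: pathstart_def pathfinish_def)
  have e_tails: "e \<subseteq> tails" by (subst e_ends) (auto simp: tails_def)
  define R where "R = verts G \<union> (\<Union>f\<in>edges G - {e}. curve f) \<union> tails"
  have "compact tails" unfolding tails_def
    by (intro compact_Un compact_continuous_image continuous_on_subset[OF cont]) auto
  then have "compact R" unfolding R_def
    by (intro compact_Un compact_curves) auto
  have mid_R: "mid \<inter> R = {}"
  proof -
    have "mid \<inter> verts G = {}"
      using ea(3) curve_split e_tails mid_tails by blast
    moreover have "mid \<inter> curve f = {}" if "f \<in> edges G - {e}" for f
      using curve_Int[OF eG, of f] that curve_split e_tails mid_tails by blast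
    ultimately show ?thesis using mid_tails unfolding R_def by blast
  qed
  have D_eq: "D = path_image g \<union> R"
  proof -
    have "path_image g \<subseteq> D" unfolding g(3) using cG curve_subset_D by blast
    moreover have "curve e \<subseteq> path_image g" unfolding g(3) using ep by blast
    moreover have "R \<subseteq> D" using curve_subset_D[OF eG] curve_split unfolding R_def drawing_def by blast
    ultimately show ?thesis unfolding R_def drawing_def by blast
  qed
  define Q where "Q = (\<Union>f\<in>cycle_edges p - {e}. curve f)"
  have Q: "connected Q" "e \<subseteq> Q" unfolding Q_def using connected_cycle_minus_edge[OF c ep] by auto
  have gR: "path_image g \<inter> R = \<gamma> e ` {0..1/4} \<union> Q \<union> \<gamma> e ` {3/4..1}"
  proof -
    have "path_image g = mid \<union> (tails \<union> Q)"
      unfolding g(3) Q_def curve_split[symmetric] Un_assoc[symmetric] using ep by blast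
    moreover have "Q \<subseteq> R" unfolding Q_def R_def using cG by blast
    moreover have "tails \<subseteq> R" unfolding R_def by blast
    ultimately have "path_image g \<inter> R = tails \<union> Q" using mid_R by blast
    then show ?thesis unfolding tails_def by blast
  qed
  have con: "connected (path_image g \<inter> R)"
  proof -
    have c1: "connected (\<gamma> e ` {0..1/4})" "connected (\<gamma> e ` {3/4..1})"
      by (intro connected_continuous_image continuous_on_subset[OF cont]; auto)+
    have "\<gamma> e 0 \<in> \<gamma> e ` {0..1/4} \<inter> Q" "\<gamma> e 1 \<in> Q \<inter> \<gamma> e ` {3/4..1}"
      using Q(2) e_ends by auto
    then show ?thesis unfolding gR using c1 Q(1)
      by (intro connected_Un) blast+
  qed
  define x where "x = \<gamma> e (1/2)"
  have "x \<in> mid" by (auto simp: x_def mid_def)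
  then have "x \<in> - R" "x \<in> curve e" using mid_R curve_split by auto
  moreover have "open (- R)" using \<open>compact R\<close> by (simp add: compact_imp_closed open_Compl)
  ultimately obtain r where r: "r > 0" "ball x r \<subseteq> - R" using openE by blast
  have near: "\<exists>a. a \<in> Z \<and> a \<in> ball x r" if "e \<in> boundary Z" for Z
  proof -
    have "x \<in> closure Z" using that \<open>x \<in> curve e\<close> by (auto simp: boundary_def frontier_def)
    then show ?thesis using r(1) by (metis closure_approachable dist_commute mem_ball)
  qed
  obtain a where a: "a \<in> X" "a \<in> ball x r" using near[OF X(2)] by blast
  obtain b where b: "b \<in> Y" "b \<in> ball x r" using near[OF Y(2)] by blast
  have out: "z \<in> outside (path_image g)" if "z \<in> Z" "Z \<in> finite_faces G \<gamma>" "Z \<noteq> F" for z Z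
  proof -
    have "Z \<inter> F = {}"
      using components_nonoverlap[OF finite_face(6)[OF that(2)] finite_face(6)[OF F(1)]] that(3)
      by simp
    moreover have "z \<notin> D" using finite_face(5)[OF that(2)] that(1) by blast
    ultimately show ?thesis using that(1) g(4) D_eq Jordan_inside_outside[OF g(1,2)] by blast
  qed
  have "connected_component (- path_image g) a b"
  proof (rule connected_component_of_subset)
    show "connected_component (outside (path_image g)) a b"
      using Jordan_inside_outside[OF g(1,2)] out[OF a(1) X(1,3)] out[OF b(1) Y(1,3)]
      by (meson connected_iff_connected_component)
    show "outside (path_image g) \<subseteq> - path_image g" using Jordan_inside_outside[OF g(1,2)] by blast
  qed
  moreover have "connected_component (- R) a b"
    by (rule connected_component_of_subset[OF _ r(2)])
      (meson a(2) b(2) connected_ball connected_iff_connected_component)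
  moreover have "compact (path_image g)" using g(1) by (simp add: compact_simple_path_image)
  moreover have "closed R" using \<open>compact R\<close> by (rule compact_imp_closed)
  ultimately have ab: "connected_component (- D) a b"
    unfolding D_eq using con by (intro Janiszewski) auto
  have "connected_component_set (- D) a = X" "connected_component_set (- D) b = Y"
    using a b finite_face(6)[OF X(1)] finite_face(6)[OF Y(1)]
    by (metis components_iff connected_component_eq)+
  with ab show "X = Y" by (metis connected_component_eq mem_Collect_eq)
qed

end


section \<open>Heights of perfect matchings\<close>

locale plane_elementary = elementary_bipartition G A B + plane G \<gamma>
  for G :: "complex ugraph" and A B \<gamma>
begin

definition edge_turn :: "complex \<Rightarrow> complex set \<Rightarrow> complex" where
  "edge_turn z e = turn z (THE a. a \<in> e \<inter> A) (THE b. b \<in> e \<inter> B)"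

text \<open>The height of a matching above a point \<open>z\<close> off the drawing is the total angle, in turns, that
  its edges sweep around \<open>z\<close> when all of them are directed from \<open>A\<close> to \<open>B\<close>. Height differences of
  two matchings are winding numbers of cycles.\<close>

definition height :: "complex \<Rightarrow> complex set set \<Rightarrow> complex" where
  "height z M = sum (edge_turn z) M"

lemma edge_turn_eq:
  assumes "a \<in> A" "b \<in> B"
  shows "edge_turn z {a, b} = turn z a b"
proof -
  have "{a, b} \<inter> A = {a}" "{a, b} \<inter> B = {b}" using assms parts by auto
  then show ?thesis by (simp add: edge_turn_def)
qed

lemma height_diff_cycle:
  assumes "perfect_matching G M" "perfect_matching G N" "is_cycle G p"
    "sym_diff M N = cycle_edges p" "z \<notin> D"
  defines "S \<equiv> \<Sum>i<length p. turn z (p ! i) (p ! (Suc i mod length p))"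
  shows "S = height z M - height z N \<or> S = - (height z M - height z N)"
  unfolding S_def height_def
proof (rule alternating_cycle_weight[OF assms(1-4)])
  show "turn z v u = - turn z u v" if "{u, v} \<in> edges G" for u v
    using that assms(5) by (rule turn_reverse)
qed (rule edge_turn_eq)

lemma height_diff_cycle_bound:
  assumes "perfect_matching G M" "perfect_matching G N" "is_cycle G p"
    "sym_diff M N = cycle_edges p" "z \<notin> D"
  shows "height z M - height z N \<in> {-1, 0, 1}"
proof -
  obtain g where g: "simple_path g" "pathfinish g = pathstart g"
    "path_image g = (\<Union>e\<in>cycle_edges p. curve e)"
    "\<And>z. z \<notin> D \<Longrightarrow>
      winding_number g z = (\<Sum>i<length p. turn z (p ! i) (p ! (Suc i mod length p)))"
    using that by (rule cycle_curve[OF assms(3)])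
  note w = g(4)[OF assms(5)]
  have "path_image g \<subseteq> D"
    unfolding g(3) using cycle_facts(4)[OF assms(3)] curve_subset_D by blast
  then have "winding_number g z \<in> {-1, 0, 1}"
    using simple_closed_path_winding_number_cases[OF g(1,2)] assms(5) by blast
  moreover define d where "d = height z M - height z N"
  ultimately have "d \<in> {-1, 0, 1}"
    using height_diff_cycle[OF assms, folded w d_def] by (auto simp: equation_minus_iff)
  then show ?thesis unfolding d_def .
qed

text \<open>The face is the inside of its periphery, which winds around the points of the face once and
  around no other point off the drawing.\<close>

lemma height_diff_face:
  assumes "perfect_matching G M" "perfect_matching G N"
    and F: "F \<in> finite_faces G \<gamma>" "is_periphery G \<gamma> p F"
    and diff: "sym_diff M N = cycle_edges p" and z: "z \<notin> D"
  shows "z \<in> F \<Longrightarrow> height z M - height z N \<in> {-1, 1}"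
    and "z \<notin> F \<Longrightarrow> height z M = height z N"
proof -
  have c: "is_cycle G p" using F(2) by (simp add: is_periphery_def)
  obtain g where g: "simple_path g" "pathfinish g = pathstart g"
    "path_image g = (\<Union>e\<in>cycle_edges p. curve e)" "F = inside (path_image g)"
    "\<And>z. z \<notin> D \<Longrightarrow>
      winding_number g z = (\<Sum>i<length p. turn z (p ! i) (p ! (Suc i mod length p)))"
    using that by (rule periphery_curve[OF F])
  note h = height_diff_cycle[OF assms(1,2) c diff z, folded g(5)[OF z]]
  show "height z M - height z N \<in> {-1, 1}" if "z \<in> F"
  proof -
    have "winding_number g z \<in> {-1, 1}"
      using simple_closed_path_winding_number_inside[OF g(1)] that g(4) by blast
    moreover define d where "d = height z M - height z N"
    ultimately have "d \<in> {-1, 1}" using h[folded d_def] by (auto simp: equation_minus_iff)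
    then show ?thesis unfolding d_def .
  qed
  show "height z M = height z N" if "z \<notin> F"
  proof -
    have "path_image g \<subseteq> D"
      unfolding g(3) using cycle_facts(4)[OF c] curve_subset_D by blast
    then have "z \<in> outside (path_image g)"
      using Jordan_inside_outside[OF g(1,2)] that z g(4) by blast
    then have "winding_number g z = 0"
      using g(1,2) by (intro winding_number_zero_in_outside simple_path_imp_path)
    then show ?thesis using h by auto
  qed
qed

text \<open>A point outside a disc that contains the drawing serves as the reference point with constant
  height.\<close>

lemma height_far:
  obtains b where "b \<notin> D" "\<And>F. F \<in> finite_faces G \<gamma> \<Longrightarrow> b \<notin> F"
    "\<And>M N p. perfect_matching G M \<Longrightarrow> perfect_matching G N \<Longrightarrow> is_cycle G p \<Longrightarrow>
      sym_diff M N = cycle_edges p \<Longrightarrow> height b M = height b N"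
proof -
  obtain r where r: "r > 0" "D \<subseteq> ball 0 r"
    using compact_imp_bounded[OF compact_D] bounded_subset_ballD by blast
  define b :: complex where "b = of_real r"
  have b: "b \<notin> ball 0 r" using r by (simp add: b_def)
  show thesis
  proof (rule that[of b])
    show "b \<notin> D" using b r by blast
    fix F assume F: "F \<in> finite_faces G \<gamma>"
    show "b \<notin> F"
    proof
      assume "b \<in> F"
      moreover have "connected (- ball 0 r :: complex set)"
        by (intro connected_complement_bounded_convex) auto
      moreover have "- ball 0 r \<subseteq> - D" using r by blast
      ultimately have "- ball 0 r \<subseteq> F"
        using components_maximal[OF finite_face(6)[OF F]] b by blast
      then have "bounded (- ball 0 r :: complex set)"
        using finite_face(3)[OF F] bounded_subset by blast
      then show False using cobounded_imp_unbounded[of "- ball 0 r :: complex set"] by simp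
    qed
  next
    fix M N p
    assume *: "perfect_matching G M" "perfect_matching G N" "is_cycle G p" "sym_diff M N = cycle_edges p"
    have bD: "b \<notin> D" using b r by blast
    obtain g where g: "simple_path g" "pathfinish g = pathstart g"
      "path_image g = (\<Union>e\<in>cycle_edges p. curve e)"
    "\<And>z. z \<notin> D \<Longrightarrow>
      winding_number g z = (\<Sum>i<length p. turn z (p ! i) (p ! (Suc i mod length p)))"
      using that by (rule cycle_curve[OF *(3)])
    have "path_image g \<subseteq> ball 0 r"
      unfolding g(3) using cycle_facts(4)[OF *(3)] curve_subset_D r by blast
    then have "winding_number g b = 0"
      using g(1,2) b by (intro winding_number_zero_outside[of g "ball 0 r"] simple_path_imp_path) auto
    then show "height b M = height b N"
      using height_diff_cycle[OF * bD] unfolding g(4)[OF bD, symmetric] by auto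
  qed
qed

text \<open>Along a single edge \<open>(x - a) / (x - b)\<close> has, up to a constant factor, a continuous logarithm
  with any prescribed value \<open>s\<close> at one end. The winding numbers of the edge then fix its value at
  the other end.\<close>

lemma edge_logarithm:
  assumes e: "{u, v} \<in> edges G" and ab: "a \<notin> D" "b \<notin> D"
  obtains L where "continuous_on (curve {u, v}) L"
    "\<And>x. x \<in> curve {u, v} \<Longrightarrow> exp (L x) = exp s * ((x - a) / (x - b)) / ((u - a) / (u - b))"
    "L u = s" "L v = s + 2 * of_real pi * \<i> * (turn a u v - turn b u v)"
proof -
  define g where "g = directed u v"
  note d = directed[OF e, folded g_def]
  have path: "path g" using d(1) by (rule arc_imp_path)
  have ab': "a \<notin> path_image g" "b \<notin> path_image g" using d(4) curve_subset_D[OF e] ab by auto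
  obtain qa where qa: "path qa"
    "pathfinish qa - pathstart qa = 2 * of_real pi * \<i> * winding_number g a"
    "\<And>t. t \<in> {0..1} \<Longrightarrow> g t = a + exp (qa t)"
    using winding_number_as_continuous_log[OF path ab'(1)] by metis
  obtain qb where qb: "path qb"
    "pathfinish qb - pathstart qb = 2 * of_real pi * \<i> * winding_number g b"
    "\<And>t. t \<in> {0..1} \<Longrightarrow> g t = b + exp (qb t)"
    using winding_number_as_continuous_log[OF path ab'(2)] by metis
  have inj: "inj_on g {0..1}" and cont: "continuous_on {0..1} g"
    using d(1) by (auto simp: arc_def path_def)
  define l where "l t = s + (qa t - qb t) - (qa 0 - qb 0)" for t
  have u: "u = g 0" and v: "v = g 1" using d(2,3) by (auto simp: pathstart_def pathfinish_def)
  define r where "r = the_inv_into {0..1} g"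
  have r: "r (g t) = t" if "t \<in> {0..1}" for t
    unfolding r_def using inj that by (rule the_inv_into_f_f)
  have img: "curve {u, v} = g ` {0..1}" using d(4) by (simp add: path_image_def)
  show thesis
  proof (rule that[of "l \<circ> r"])
    have "continuous_on (g ` {0..1}) r"
      unfolding r_def by (rule continuous_on_inv_into[OF cont compact_Icc inj])
    moreover have "r ` g ` {0..1} = {0..1}" using r by (auto simp: image_iff)
    moreover have "continuous_on {0..1} l"
      unfolding l_def using qa(1) qb(1) by (intro continuous_intros) (auto simp: path_def)
    ultimately show "continuous_on (curve {u, v}) (l \<circ> r)"
      unfolding img by (intro continuous_on_compose) auto
    fix x assume "x \<in> curve {u, v}"
    then obtain t where t: "t \<in> {0..1}" "x = g t" using img by blast
    have "x - a = exp (qa t)" "x - b = exp (qb t)" "u - a = exp (qa 0)" "u - b = exp (qb 0)"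
      using t qa(3)[of t] qb(3)[of t] qa(3)[of 0] qb(3)[of 0] u by (simp_all add: algebra_simps)
    moreover have "exp ((l \<circ> r) x) = exp s * (exp (qa t) / exp (qb t)) / (exp (qa 0) / exp (qb 0))"
      using t r by (simp add: l_def exp_add exp_diff)
    ultimately show "exp ((l \<circ> r) x) = exp s * ((x - a) / (x - b)) / ((u - a) / (u - b))"
      by (simp only:)
  next
    show "(l \<circ> r) u = s" using r[of 0] u by (simp add: l_def)
    show "(l \<circ> r) v = s + 2 * of_real pi * \<i> * (turn a u v - turn b u v)"
    proof -
      have "(l \<circ> r) v = s + (qa 1 - qa 0) - (qb 1 - qb 0)"
        using r[of 1] v by (simp add: l_def)
      also have "qa 1 - qa 0 = 2 * of_real pi * \<i> * turn a u v"
        using qa(2) by (simp only: turn_def g_def pathstart_def pathfinish_def)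
      also have "qb 1 - qb 0 = 2 * of_real pi * \<i> * turn b u v"
        using qb(2) by (simp only: turn_def g_def pathstart_def pathfinish_def)
      finally show ?thesis by (simp add: right_diff_distrib)
    qed
  qed
qed

text \<open>Equal height differences mean that the edge turns about \<open>a\<close> and \<open>b\<close> differ by a potential,
  and the logarithms along the edges fit together to a continuous logarithm of
  \<open>(x - a) / (x - b)\<close> on the whole drawing. By Borsuk's criterion the drawing then does not
  separate \<open>a\<close> from \<open>b\<close>.\<close>

theorem same_height_imp_connected:
  assumes ab: "a \<notin> D" "b \<notin> D" and M: "perfect_matching G M"
    and eq: "\<And>N p. perfect_matching G N \<Longrightarrow> is_cycle G p \<Longrightarrow> sym_diff N M = cycle_edges p \<Longrightarrow>
      height a N - height a M = height b N - height b M"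
  shows "connected_component (- D) a b"
proof -
  let ?c = "2 * of_real pi * \<i>"
  define q where "q x = (x - a) / (x - b)" for x
  have q_nz: "q x \<noteq> 0" if "x \<in> D" for x using that ab by (auto simp: q_def)
  obtain \<pi> where pi: "\<And>x y. x \<in> A \<Longrightarrow> y \<in> B \<Longrightarrow> {x, y} \<in> edges G \<Longrightarrow>
      edge_turn a {x, y} - edge_turn b {x, y} = \<pi> y - \<pi> x"
  proof (rule potential_of_matching_invariant[OF M, of "\<lambda>e. edge_turn a e - edge_turn b e"])
    fix N p assume "perfect_matching G N" "is_cycle G p" "sym_diff N M = cycle_edges p"
    from eq[OF this] show "(\<Sum>e\<in>N. edge_turn a e - edge_turn b e) = (\<Sum>e\<in>M. edge_turn a e - edge_turn b e)"
      by (simp add: height_def sum_subtractf algebra_simps)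
  qed metis
  have pot: "turn a u v - turn b u v = \<pi> v - \<pi> u" if e: "{u, v} \<in> edges G" for u v
  proof -
    obtain x y where xy: "x \<in> A" "y \<in> B" "{u, v} = {x, y}" using bip[OF e] by blast
    then have "turn a x y - turn b x y = \<pi> y - \<pi> x" using pi[of x y] e by (simp add: edge_turn_eq)
    moreover have "turn a y x = - turn a x y" "turn b y x = - turn b x y"
      using turn_reverse ab e xy(3) by auto
    moreover have "u = x \<and> v = y \<or> u = y \<and> v = x" using xy(3) by (simp only: doubleton_eq_iff)
    ultimately show ?thesis by (elim disjE conjE) (simp_all only: minus_diff_minus minus_diff_eq)
  qed
  have edge_log: "\<exists>L. continuous_on (curve {u, v}) L \<and>
      (\<forall>x\<in>curve {u, v}. exp (L x) = exp (?c * \<pi> u) / q u * q x) \<and> L u = ?c * \<pi> u \<and> L v = ?c * \<pi> v"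
    if e: "{u, v} \<in> edges G" for u v
  proof -
    obtain L where "continuous_on (curve {u, v}) L"
      "\<And>x. x \<in> curve {u, v} \<Longrightarrow> exp (L x) = exp (?c * \<pi> u) * q x / q u"
      "L u = ?c * \<pi> u" "L v = ?c * \<pi> u + ?c * (turn a u v - turn b u v)"
      using that by (rule edge_logarithm[OF e ab, of "?c * \<pi> u", folded q_def])
    moreover have "?c * \<pi> u + ?c * (turn a u v - turn b u v) = ?c * \<pi> v"
      unfolding pot[OF e] by (simp add: algebra_simps)
    ultimately show ?thesis by (intro exI[of _ L]) simp
  qed
  have vert_D: "v \<in> D" if "v \<in> verts G" for v using that by (simp add: drawing_def)
  \<comment> \<open>one constant factor serves for all edges, since \<open>G\<close> is connected\<close>
  obtain K where K: "\<And>v. v \<in> verts G \<Longrightarrow> exp (?c * \<pi> v) = K * q v" "K \<noteq> 0"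
  proof -
    obtain r where r: "r \<in> verts G" using verts_nonempty by blast
    define K where "K = exp (?c * \<pi> r) / q r"
    have "exp (?c * \<pi> v) / q v = K" if v: "v \<in> verts G" for v
    proof (rule edge_connected[where P = "\<lambda>v. exp (?c * \<pi> v) / q v = K", OF r v])
      fix x y assume xy: "{x, y} \<in> edges G" "exp (?c * \<pi> x) / q x = K"
      obtain L where L: "\<forall>z\<in>curve {x, y}. exp (L z) = exp (?c * \<pi> x) / q x * q z" "L y = ?c * \<pi> y"
        using edge_log[OF xy(1)] by blast
      have y: "y \<in> curve {x, y}" "y \<in> D"
        using edge_subset_curve[OF xy(1)] curve_subset_D[OF xy(1)] by auto
      then have "exp (?c * \<pi> y) = K * q y" using L xy(2) by metis
      then show "exp (?c * \<pi> y) / q y = K" using q_nz[OF y(2)] by simp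
    qed (simp add: K_def)
    then have "exp (?c * \<pi> v) = K * q v" if "v \<in> verts G" for v
      using that q_nz[OF vert_D[OF that]] by (simp add: divide_eq_eq)
    moreover have "K \<noteq> 0" unfolding K_def using q_nz[OF vert_D[OF r]] by simp
    ultimately show thesis by (rule that)
  qed
  have "\<exists>L. continuous_on (curve e) L \<and> (\<forall>x\<in>curve e. exp (L x) = K * q x) \<and>
      (\<forall>v\<in>e. L v = ?c * \<pi> v)" if e: "e \<in> edges G" for e
  proof -
    obtain u v where uv: "e = {u, v}" using bip[OF e] by blast
    have u: "u \<in> verts G" using edge_subset_verts[OF e] uv by blast
    then have "exp (?c * \<pi> u) / q u = K" using K(1) q_nz[OF vert_D] by simp
    then show ?thesis using edge_log[of u v] e uv by auto
  qed
  then obtain L where L: "\<And>e. e \<in> edges G \<Longrightarrow> continuous_on (curve e) (L e) \<and>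
      (\<forall>x\<in>curve e. exp (L e x) = K * q x) \<and> (\<forall>v\<in>e. L e v = ?c * \<pi> v)" by metis
  define l where "l x = L (SOME e. e \<in> edges G \<and> x \<in> curve e) x" for x
  have l: "l x = L e x" if e: "e \<in> edges G" "x \<in> curve e" for e x
  proof -
    define f where "f = (SOME e. e \<in> edges G \<and> x \<in> curve e)"
    have f: "f \<in> edges G \<and> x \<in> curve f" unfolding f_def by (rule someI) (use e in blast)
    show ?thesis
    proof (cases "f = e")
      case False
      then have "x \<in> e \<inter> f" using curve_Int[of e f] e f by blast
      then show ?thesis using L[OF e(1)] L[of f] f by (simp add: l_def f_def[symmetric])
    qed (simp add: l_def f_def)
  qed
  have D_eq: "D = (\<Union>e\<in>edges G. curve e)"
  proof -
    have "v \<in> (\<Union>e\<in>edges G. curve e)" if v: "v \<in> verts G" for v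
    proof -
      obtain e where e: "e \<in> edges G" "v \<in> e" by (rule vertex_on_edge[OF v])
      from edge_subset_curve[OF e(1)] e(2) have "v \<in> curve e" by (rule subsetD)
      with e(1) show ?thesis by (rule UN_I)
    qed
    then show ?thesis unfolding drawing_def by (intro Un_absorb1) (rule subsetI)
  qed
  have cont: "continuous_on D l"
    unfolding D_eq
  proof (rule continuous_on_closed_Union[OF finite_edges])
    fix e assume e: "e \<in> edges G"
    show "closed (curve e)" using edge_arc(1)[OF e] by (intro closed_path_image arc_imp_path)
    show "continuous_on (curve e) l"
      using L[OF e] l[OF e] continuous_on_cong[of "curve e" "curve e" l "L e"] by simp
  qed
  have exp_l: "exp (l x) = K * q x" if x: "x \<in> D" for x
  proof -
    obtain e where e: "e \<in> edges G" "x \<in> curve e" using x unfolding D_eq by blast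
    then show ?thesis using L[OF e(1)] l[OF e] by simp
  qed
  obtain \<kappa> where \<kappa>: "exp \<kappa> = K" using K(2) exp_Ln by blast
  define h where "h x = Im (l x - \<kappa>)" for x
  have "exp (\<i> * of_real (h x)) = ((x - a) /\<^sub>R cmod (x - a)) / ((x - b) /\<^sub>R cmod (x - b))"
    if x: "x \<in> D" for x
  proof -
    have qx: "q x = exp (l x - \<kappa>)" using exp_l[OF x] \<kappa> K(2) by (simp add: exp_diff)
    have "exp (l x - \<kappa>) = of_real (cmod (exp (l x - \<kappa>))) * exp (\<i> * of_real (h x))"
      unfolding h_def norm_exp_eq_Re cis_conv_exp[symmetric] by (rule exp_eq_polar)
    then have "q x = of_real (cmod (q x)) * exp (\<i> * of_real (h x))" unfolding qx .
    then have "exp (\<i> * of_real (h x)) = q x / of_real (cmod (q x))"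
      using q_nz[OF x] by (metis nonzero_mult_div_cancel_left norm_eq_zero of_real_eq_0_iff)
    also have "\<dots> = ((x - a) /\<^sub>R cmod (x - a)) / ((x - b) /\<^sub>R cmod (x - b))"
      by (simp add: q_def norm_mult norm_inverse scaleR_conv_of_real divide_inverse)
    finally show ?thesis .
  qed
  moreover have "continuous_on D h" unfolding h_def by (intro continuous_intros cont)
  ultimately have "\<exists>c. homotopic_with_canon (\<lambda>x. True) D (sphere 0 1)
      (\<lambda>x. ((x - a) /\<^sub>R cmod (x - a)) / ((x - b) /\<^sub>R cmod (x - b))) (\<lambda>x. c)"
    unfolding inessential_eq_continuous_logarithm_circle by metis
  moreover have "continuous_on D (\<lambda>x. (x - z) /\<^sub>R cmod (x - z))" if "z \<notin> D" for z
    using that by (intro continuous_intros) auto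
  moreover have "(\<lambda>x. (x - z) /\<^sub>R cmod (x - z)) \<in> D \<rightarrow> sphere 0 1" if "z \<notin> D" for z
  proof (rule funcsetI)
    fix x assume "x \<in> D"
    then have "x \<noteq> z" using that by blast
    then show "(x - z) /\<^sub>R cmod (x - z) \<in> sphere 0 1" by simp
  qed
  ultimately have "homotopic_with_canon (\<lambda>x. True) D (sphere 0 1)
      (\<lambda>x. (x - a) /\<^sub>R cmod (x - a)) (\<lambda>x. (x - b) /\<^sub>R cmod (x - b))"
    using ab by (subst homotopic_circlemaps_divide) auto
  then show ?thesis
    using Borsuk_maps_homotopic_in_connected_component_eq[OF compact_D ab] by simp
qed

text \<open>A face is determined by the heights above it, relative to a fixed matching \<open>M\<close>, of the
  matchings that differ from \<open>M\<close> by a cycle. These are finitely many matchings, and their relative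
  heights are -1, 0 or 1 as winding numbers of Jordan curves.\<close>

lemma finite_finite_faces: "finite (finite_faces G \<gamma>)"
proof -
  obtain M where M: "perfect_matching G M" using elem by (auto simp: elementary_graph_def)
  define z where "z F = (SOME z. z \<in> F)" for F :: "complex set"
  have z: "z F \<in> F" "z F \<notin> D" if "F \<in> finite_faces G \<gamma>" for F
  proof -
    show "z F \<in> F" unfolding z_def using finite_face(4)[OF that] by (simp add: some_in_eq)
    then show "z F \<notin> D" using finite_face(5)[OF that] by blast
  qed
  define code where "code F = {(N, height (z F) N - height (z F) M) | N.
      perfect_matching G N \<and> (\<exists>p. is_cycle G p \<and> sym_diff N M = cycle_edges p)}" for F
  have "inj_on code (finite_faces G \<gamma>)"
  proof (rule inj_onI)
    fix E F assume EF: "E \<in> finite_faces G \<gamma>" "F \<in> finite_faces G \<gamma>" "code E = code F"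
    have "connected_component (- D) (z E) (z F)"
    proof (rule same_height_imp_connected[OF z(2)[OF EF(1)] z(2)[OF EF(2)] M])
      fix N p assume "perfect_matching G N" "is_cycle G p" "sym_diff N M = cycle_edges p"
      then have "(N, height (z E) N - height (z E) M) \<in> code E" unfolding code_def by blast
      then show "height (z E) N - height (z E) M = height (z F) N - height (z F) M"
        unfolding EF(3) by (auto simp: code_def)
    qed
    moreover have "connected_component_set (- D) (z E) = E" "connected_component_set (- D) (z F) = F"
      using z(1)[OF EF(1)] z(1)[OF EF(2)] finite_face(6)[OF EF(1)] finite_face(6)[OF EF(2)]
      by (metis components_iff connected_component_eq)+
    ultimately show "E = F" by (metis connected_component_eq mem_Collect_eq)
  qed
  moreover have "code ` finite_faces G \<gamma> \<subseteq> Pow ({N. perfect_matching G N} \<times> {-1, 0, 1})"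
    using height_diff_cycle_bound M z by (force simp: code_def)
  moreover have "finite (Pow ({N. perfect_matching G N} \<times> {-1, 0, 1 :: complex}))"
    using finite_matchings by simp
  ultimately show ?thesis using finite_subset finite_imageD by meson
qed

end


section \<open>Graphs encoded by families of sets\<close>

text \<open>The common form of daisy cubes, the graphs \<open>DI H\<close> and simplex graphs: isomorphisms between them
  then are bijections of set families that preserve the size of symmetric differences.\<close>

definition set_family_graph :: "'a ugraph \<Rightarrow> ('b set \<Rightarrow> 'a) \<Rightarrow> 'b set set \<Rightarrow> bool" where
  "set_family_graph H f S \<longleftrightarrow> bij_betw f S (verts H) \<and>
     (\<forall>X\<in>S. \<forall>Y\<in>S. {f X, f Y} \<in> edges H \<longleftrightarrow> card (sym_diff X Y) = 1)"

lemma graph_iso_trans: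
  assumes "graph_iso G H" "graph_iso H K"
  shows "graph_iso G K"
proof -
  obtain f g where f: "bij_betw f (verts G) (verts H)"
    "\<And>u v. u \<in> verts G \<Longrightarrow> v \<in> verts G \<Longrightarrow> {u, v} \<in> edges G \<longleftrightarrow> {f u, f v} \<in> edges H"
    and g: "bij_betw g (verts H) (verts K)"
    "\<And>u v. u \<in> verts H \<Longrightarrow> v \<in> verts H \<Longrightarrow> {u, v} \<in> edges H \<longleftrightarrow> {g u, g v} \<in> edges K"
    using assms unfolding graph_iso_def by blast
  have "f u \<in> verts H" if "u \<in> verts G" for u using f(1) that by (auto simp: bij_betw_def)
  then show ?thesis unfolding graph_iso_def
    using bij_betw_trans[OF f(1) g(1)] f(2) g(2) by (intro exI[of _ "g \<circ> f"]) simp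
qed

lemma graph_iso_sym:
  assumes "graph_iso G H"
  shows "graph_iso H G"
proof -
  obtain f where f: "bij_betw f (verts G) (verts H)"
    "\<And>u v. u \<in> verts G \<Longrightarrow> v \<in> verts G \<Longrightarrow> {u, v} \<in> edges G \<longleftrightarrow> {f u, f v} \<in> edges H"
    using assms unfolding graph_iso_def by blast
  define g where "g = the_inv_into (verts G) f"
  have "bij_betw g (verts H) (verts G)" unfolding g_def by (rule bij_betw_the_inv_into[OF f(1)])
  moreover have "g u \<in> verts G" "f (g u) = u" if "u \<in> verts H" for u
    using f(1) that calculation unfolding g_def
    by (auto simp: bij_betw_def f_the_inv_into_f)
  ultimately show ?thesis unfolding graph_iso_def using f(2) by (intro exI[of _ g]) simp
qed

lemma set_family_iso:
  assumes S: "set_family_graph G f S" and T: "set_family_graph H g T"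
    and h: "bij_betw h S T"
      "\<And>X Y. X \<in> S \<Longrightarrow> Y \<in> S \<Longrightarrow> card (sym_diff (h X) (h Y)) = 1 \<longleftrightarrow> card (sym_diff X Y) = 1"
  shows "graph_iso G H"
proof -
  define k where "k = the_inv_into S f"
  have k: "bij_betw k (verts G) S"
    unfolding k_def using S by (intro bij_betw_the_inv_into) (simp add: set_family_graph_def)
  have kS: "k u \<in> S" "f (k u) = u" if "u \<in> verts G" for u
    using S k that unfolding k_def
    by (auto simp: set_family_graph_def bij_betw_def f_the_inv_into_f)
  have "bij_betw (g \<circ> (h \<circ> k)) (verts G) (verts H)"
    using T k h(1) by (intro bij_betw_trans) (auto simp: set_family_graph_def)
  moreover have "{u, v} \<in> edges G \<longleftrightarrow> {(g \<circ> (h \<circ> k)) u, (g \<circ> (h \<circ> k)) v} \<in> edges H"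
    if uv: "u \<in> verts G" "v \<in> verts G" for u v
  proof -
    have "{u, v} \<in> edges G \<longleftrightarrow> card (sym_diff (k u) (k v)) = 1"
      using S kS[OF uv(1)] kS[OF uv(2)] unfolding set_family_graph_def by metis
    also have "\<dots> \<longleftrightarrow> card (sym_diff (h (k u)) (h (k v))) = 1"
      using h(2) kS(1)[OF uv(1)] kS(1)[OF uv(2)] by simp
    also have "\<dots> \<longleftrightarrow> {g (h (k u)), g (h (k v))} \<in> edges H"
    proof -
      have "h (k u) \<in> T" "h (k v) \<in> T"
        using h(1) kS(1)[OF uv(1)] kS(1)[OF uv(2)] by (auto simp: bij_betw_def)
      then show ?thesis using T unfolding set_family_graph_def by metis
    qed
    finally show ?thesis by simp
  qed
  ultimately show ?thesis unfolding graph_iso_def by blast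
qed

lemma independent_subset: "independent_set H I \<Longrightarrow> J \<subseteq> I \<Longrightarrow> independent_set H J"
  unfolding independent_set_def by blast

text \<open>Every independent set of a finite graph extends to a maximal one.\<close>

lemma below_max_independent:
  assumes "finite (verts H)"
  shows "{A. \<exists>I. max_independent_set H I \<and> A \<subseteq> I} = {I. independent_set H I}"
proof (intro equalityI subsetI)
  fix A assume "A \<in> {A. \<exists>I. max_independent_set H I \<and> A \<subseteq> I}"
  then show "A \<in> {I. independent_set H I}"
    using independent_subset unfolding max_independent_set_def by blast
next
  fix A assume A: "A \<in> {I. independent_set H I}"
  define W where "W = {I. independent_set H I \<and> A \<subseteq> I}"
  have "finite W" "A \<in> W"
    using A assms finite_subset[of W "Pow (verts H)"] by (auto simp: W_def independent_set_def)
  then obtain I where "I \<in> W" "\<And>J. J \<in> W \<Longrightarrow> I \<subseteq> J \<Longrightarrow> J = I"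
    by (metis finite_has_maximal2)
  then have "max_independent_set H I \<and> A \<subseteq> I"
    unfolding W_def max_independent_set_def by blast
  then show "A \<in> {A. \<exists>I. max_independent_set H I \<and> A \<subseteq> I}" by blast
qed

lemma DI_set_family:
  assumes "finite (verts H)"
  obtains f where "set_family_graph (DI H) f {I. independent_set H I}"
proof -
  define vs where "vs = (SOME vs. distinct vs \<and> set vs = verts H)"
  have "\<exists>vs. distinct vs \<and> set vs = verts H"
    using finite_distinct_list[OF assms] by blast
  then have "distinct vs \<and> set vs = verts H"
    unfolding vs_def by (rule someI_ex)
  then have vs: "distinct vs" "set vs = verts H" by auto
  have "set_family_graph (DI H) (char_string vs) {I. independent_set H I}"
    using DI_wrt_char_string[OF vs] below_max_independent[OF assms]
    unfolding set_family_graph_def DI_def vs_def[symmetric] by simp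
  then show thesis by (rule that)
qed

lemma simplex_set_family:
  assumes "\<And>u. {u} \<notin> edges H"
  shows "set_family_graph (simplex_graph (complement_graph H)) id {I. independent_set H I}"
proof -
  have clique: "clique (complement_graph H) K \<longleftrightarrow> independent_set H K" for K
  proof -
    have key: "(u \<noteq> v \<longrightarrow> {u, v} \<in> edges (complement_graph H)) \<longleftrightarrow> {u, v} \<notin> edges H"
      if "u \<in> verts H" "v \<in> verts H" for u v
    proof (cases "u = v")
      case True
      then show ?thesis using assms[of v] by simp
    next
      case False
      then have "{u, v} \<in> edges (complement_graph H) \<longleftrightarrow> {u, v} \<notin> edges H"
        using that by (auto simp: complement_graph_def doubleton_eq_iff insert_commute)
      then show ?thesis using False by simp
    qed
    have vs: "verts (complement_graph H) = verts H" by (simp add: complement_graph_def)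
    show ?thesis unfolding clique_def independent_set_def vs
      by (intro conj_cong refl ball_cong key) auto
  qed
  have "{K, L} \<in> edges (simplex_graph (complement_graph H)) \<longleftrightarrow> card (sym_diff K L) = 1"
    if "independent_set H K" "independent_set H L" for K L
    using that by (auto simp: simplex_graph_def clique doubleton_eq_iff Un_commute)
  then show ?thesis
    by (auto simp: set_family_graph_def simplex_graph_def clique bij_betw_def)
qed

lemma DI_iso_simplex:
  assumes "finite (verts H)" "\<And>u. {u} \<notin> edges H"
  shows "graph_iso (DI H) (simplex_graph (complement_graph H))"
proof -
  obtain f where "set_family_graph (DI H) f {I. independent_set H I}"
    using DI_set_family[OF assms(1)] .
  from set_family_iso[OF this simplex_set_family[OF assms(2)], of id]
  show ?thesis by simp
qed

lemma string_le_trans: "string_le u v \<Longrightarrow> string_le v w \<Longrightarrow> string_le u w"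
  unfolding string_le_def using list_all2_trans[of "(\<le>)" "(\<le>)" "(\<le>)" u v w] order_trans by blast

lemma daisy_cube_DI:
  assumes "graph_iso G (DI H)"
  shows "daisy_cube G"
proof -
  define vs where "vs = (SOME vs. distinct vs \<and> set vs = verts H)"
  define U where "U = {u \<in> bin_strings (length vs).
    \<exists>I. max_independent_set H I \<and> string_le u (char_string vs I)}"
  have "DI H = induced (hypercube (length vs)) U"
    by (simp add: DI_def DI_wrt_def vs_def U_def)
  moreover have "u \<in> U" if "v \<in> U" "string_le u v" for u v
    using that string_le_trans[OF that(2)]
    by (auto simp: U_def bin_strings_def string_le_def dest: list_all2_lengthD)
  moreover have "U \<subseteq> bin_strings (length vs)" by (auto simp: U_def)
  ultimately show ?thesis using assms unfolding daisy_cube_def by metis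
qed

lemma daisy_cube_set_family:
  assumes "daisy_cube H"
  obtains f :: "nat set \<Rightarrow> 'a" and S where "set_family_graph H f S"
    "\<And>X Y. X \<in> S \<Longrightarrow> Y \<subseteq> X \<Longrightarrow> Y \<in> S" "\<And>X. X \<in> S \<Longrightarrow> finite X"
proof -
  obtain n U where U: "U \<subseteq> bin_strings n"
    "\<And>u v. v \<in> U \<Longrightarrow> string_le u v \<Longrightarrow> u \<in> U" "graph_iso H (induced (hypercube n) U)"
    using assms unfolding daisy_cube_def by blast
  let ?Q = "induced (hypercube n) U"
  obtain h where h: "bij_betw h (verts ?Q) (verts H)"
    "\<And>u v. u \<in> verts ?Q \<Longrightarrow> v \<in> verts ?Q \<Longrightarrow> {u, v} \<in> edges ?Q \<longleftrightarrow> {h u, h v} \<in> edges H"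
    using graph_iso_sym[OF U(3)] unfolding graph_iso_def by blast
  define c where "c = char_string [0..<n]"
  have vQ: "verts ?Q = U" using U(1) by (auto simp: induced_def hypercube_def)
  have eQ: "{u, v} \<in> edges ?Q \<longleftrightarrow> card {i. i < n \<and> u ! i \<noteq> v ! i} = 1" if "u \<in> U" "v \<in> U" for u v
  proof -
    have "{i. i < n \<and> v ! i \<noteq> u ! i} = {i. i < n \<and> u ! i \<noteq> v ! i}" by auto
    then show ?thesis
      using that U(1) by (auto simp: induced_def hypercube_def doubleton_eq_iff)
  qed
  define S where "S = {X. X \<subseteq> {..<n} \<and> c X \<in> U}"
  have bij: "bij_betw c (Pow {..<n}) (bin_strings n)"
    using char_string_bij[of "[0..<n]"] by (simp add: c_def lessThan_atLeast0)
  have "bij_betw c S U"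
  proof (rule bij_betw_subset[OF bij])
    show "c ` S = U"
    proof (intro equalityI subsetI)
      fix u assume u: "u \<in> U"
      then obtain X where "X \<subseteq> {..<n}" "u = c X" using bij U(1) unfolding bij_betw_def by blast
      with u show "u \<in> c ` S" by (auto simp: S_def)
    qed (auto simp: S_def)
  qed (auto simp: S_def)
  then have "bij_betw (h \<circ> c) S (verts H)" using h(1) unfolding vQ by (rule bij_betw_trans)
  moreover have "{(h \<circ> c) X, (h \<circ> c) Y} \<in> edges H \<longleftrightarrow> card (sym_diff X Y) = 1"
    if "X \<in> S" "Y \<in> S" for X Y
  proof -
    have "X \<subseteq> set [0..<n]" "Y \<subseteq> set [0..<n]" using that by (auto simp: S_def)
    from char_string_diff[OF distinct_upt this]
    have "card {i. i < n \<and> c X ! i \<noteq> c Y ! i} = card (sym_diff X Y)" unfolding c_def by simp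
    moreover have "c X \<in> U" "c Y \<in> U" using that by (auto simp: S_def)
    ultimately show ?thesis using h(2)[of "c X" "c Y"] eQ[of "c X" "c Y"] unfolding vQ by simp
  qed
  ultimately have "set_family_graph H (h \<circ> c) S" by (simp add: set_family_graph_def)
  moreover have "Y \<in> S" if "X \<in> S" "Y \<subseteq> X" for X Y
  proof -
    have "Y \<subseteq> {..<n}" "Y \<subseteq> set [0..<n]" using that by (auto simp: S_def)
    then show ?thesis
      using that U(2)[of "c X" "c Y"] char_string_le[of Y "[0..<n]" X] by (simp add: S_def c_def)
  qed
  moreover have "finite X" if "X \<in> S" for X
    using that finite_subset[of X "{..<n}"] by (simp add: S_def)
  ultimately show thesis by (rule that)
qed


section \<open>Rotations of faces\<close>

context bipartition
begin

lemma matched_in_sym_diff: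
  assumes "perfect_matching G M" "perfect_matching G N" "v \<in> \<Union>(sym_diff M N)" "e \<in> M" "v \<in> e"
  shows "e \<in> sym_diff M N"
proof -
  obtain f where f: "f \<in> sym_diff M N" "v \<in> f" using assms(3) by blast
  show ?thesis
  proof (cases "f \<in> M")
    case True
    then have "f = e" using matching_unique[OF assms(1) _ assms(4) _ assms(5)] f(2) by blast
    then show ?thesis using f(1) by blast
  next
    case False
    then have "f \<in> N" "f \<noteq> e" using f(1) assms(4) by auto
    then have "e \<notin> N" using matching_unique[OF assms(2) _ _ f(2) assms(5)] by blast
    then show ?thesis using assms(4) by blast
  qed
qed

text \<open>Consider four matchings \<open>M\<close>, \<open>M1\<close>, \<open>M2\<close>, \<open>M3\<close> that form a square in which opposite sides
  rotate the same cycle. At a vertex common to both cycles the two cycles share not only the edge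
  of \<open>M\<close> but also the edge of \<open>M1\<close>; following one cycle, it is seen to be part of the other.\<close>

lemma commuting_rotations_subset:
  assumes PM: "perfect_matching G M" "perfect_matching G M1" "perfect_matching G M2" "perfect_matching G M3"
    and F: "sym_diff M M1 = cycle_edges p" "sym_diff M2 M3 = cycle_edges p" "is_cycle G p"
    and E: "sym_diff M M2 = E" "sym_diff M1 M3 = E"
    and v: "v \<in> \<Union>(cycle_edges p)" "v \<in> \<Union>E"
  shows "cycle_edges p \<subseteq> E"
proof -
  define W where "W = {v. \<exists>e \<in> M. v \<in> e \<and> e \<in> cycle_edges p \<and> e \<in> E}"
  have WI: "x \<in> W" if x: "x \<in> \<Union>(cycle_edges p)" "x \<in> \<Union>E" for x
  proof -
    have "\<Union>(cycle_edges p) \<subseteq> verts G"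
      using F(3) edge_subset_verts unfolding is_cycle_def by blast
    then obtain e where e: "e \<in> M" "x \<in> e" using matching_covers[OF PM(1), of x] x(1) by blast
    have "e \<in> cycle_edges p"
      unfolding F(1)[symmetric]
      by (rule matched_in_sym_diff[OF PM(1,2) _ e]) (use x(1) F(1) in simp)
    moreover have "e \<in> E"
      unfolding E(1)[symmetric]
      by (rule matched_in_sym_diff[OF PM(1,3) _ e]) (use x(2) E(1) in simp)
    ultimately show ?thesis using e unfolding W_def by blast
  qed
  have shared: "f \<in> E" if x: "x \<in> W" and f: "f \<in> cycle_edges p" "x \<in> f" for x f
  proof -
    obtain e where e: "e \<in> M" "x \<in> e" "e \<in> cycle_edges p" "e \<in> E" using x unfolding W_def by blast
    show ?thesis
    proof (cases "f \<in> M")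
      case True
      then have "f = e" using matching_unique[OF PM(1) _ e(1) f(2) e(2)] by blast
      then show ?thesis using e(4) by simp
    next
      case False
      then have f1: "f \<in> M1" using f(1) F(1) by blast
      have "e \<notin> M2" using e(1,4) E(1) by blast
      then have "e \<in> M3" using e(3) F(2) by blast
      moreover have "e \<noteq> f" using e(1) False by blast
      ultimately have "f \<notin> M3" using matching_unique[OF PM(4) _ _ e(2) f(2)] by blast
      then show ?thesis using f1 E(2) by blast
    qed
  qed
  have "x \<in> W" if "x \<in> set p" for x
  proof (rule cycle_induct_connected[OF F(3), of v "\<lambda>x. x \<in> W"])
    show "v \<in> set p" using v(1) Union_cycle_edges[OF F(3)] by simp
    show "v \<in> W" by (rule WI[OF v])
    show "y \<in> W" if "{x, y} \<in> cycle_edges p" "x \<in> W" for x y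
    proof (rule WI)
      have "{x, y} \<in> E" using shared[OF that(2,1)] by simp
      then show "y \<in> \<Union>E" by blast
      show "y \<in> \<Union>(cycle_edges p)" using that(1) by blast
    qed
  qed (rule that)
  then have W: "\<Union>(cycle_edges p) \<subseteq> W" unfolding Union_cycle_edges[OF F(3)] by blast
  show ?thesis
  proof
    fix f assume f: "f \<in> cycle_edges p"
    then have "f \<noteq> {}" by (auto simp: cycle_edges_image)
    then obtain x where "x \<in> f" by blast
    then show "f \<in> E" using shared[of x f] W f by blast
  qed
qed

text \<open>At the vertices of the rotated cycle \<open>M'\<close> has the same edges as \<open>M\<close>, so after the rotation it
  has those of \<open>N\<close>; elsewhere it does not change.\<close>

lemma matching_rotate_disjoint:
  assumes PM: "perfect_matching G M" "perfect_matching G N" "perfect_matching G M'"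
    and M': "M' = sym_diff M U" and disj: "\<Union>U \<inter> \<Union>(sym_diff M N) = {}"
  shows "perfect_matching G (sym_diff M' (sym_diff M N))"
  unfolding perfect_matching_def
proof (intro conjI ballI)
  let ?K = "sym_diff M' (sym_diff M N)"
  show "?K \<subseteq> edges G" using PM matching_edges by blast
  fix v assume v: "v \<in> verts G"
  show "\<exists>!e. e \<in> ?K \<and> v \<in> e"
  proof (cases "v \<in> \<Union>(sym_diff M N)")
    case True
    then have "v \<notin> \<Union>U" using disj by blast
    then have "e \<in> ?K \<and> v \<in> e \<longleftrightarrow> e \<in> N \<and> v \<in> e" for e using M' by blast
    then show ?thesis using PM(2) v unfolding perfect_matching_def by simp
  next
    case False
    then have "e \<in> ?K \<and> v \<in> e \<longleftrightarrow> e \<in> M' \<and> v \<in> e" for e by blast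
    then show ?thesis using PM(3) v unfolding perfect_matching_def by simp
  qed
qed

lemma sum_card_Int_matching:
  assumes M: "perfect_matching G M" and X: "X \<subseteq> verts G"
  shows "(\<Sum>e\<in>M. card (e \<inter> X)) = card X"
proof -
  have "finite X" using X fin finite_subset by (auto simp: fin_graph_def)
  have "X = (\<Union>e\<in>M. e \<inter> X)" using matching_covers[OF M] X by blast
  then have "card X = card (\<Union>e\<in>M. e \<inter> X)" by simp
  also have "\<dots> = (\<Sum>e\<in>M. card (e \<inter> X))"
  proof (rule card_UN_disjoint[OF finite_matching[OF M]])
    show "\<forall>e\<in>M. finite (e \<inter> X)" using \<open>finite X\<close> by blast
    show "\<forall>e\<in>M. \<forall>f\<in>M. e \<noteq> f \<longrightarrow> (e \<inter> X) \<inter> (f \<inter> X) = {}"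
      using matching_unique[OF M] by blast
  qed
  finally show ?thesis by simp
qed

end

context plane_elementary
begin

definition rotates :: "complex set \<Rightarrow> complex set set \<Rightarrow> complex set set \<Rightarrow> bool" where
  "rotates F M N \<longleftrightarrow> perfect_matching G M \<and> perfect_matching G N \<and> F \<in> finite_faces G \<gamma> \<and>
     (\<exists>p. is_periphery G \<gamma> p F) \<and> sym_diff M N = boundary F"

lemma resonance_edge_iff: "{M, N} \<in> edges (resonance_graph G \<gamma>) \<longleftrightarrow> (\<exists>F. rotates F M N)"
proof
  assume "{M, N} \<in> edges (resonance_graph G \<gamma>)"
  then obtain M' N' F p where *: "{M, N} = {M', N'}" "perfect_matching G M'" "perfect_matching G N'"
    "F \<in> finite_faces G \<gamma>" "is_periphery G \<gamma> p F" "sym_diff M' N' = cycle_edges p"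
    unfolding resonance_graph_def by auto
  have "sym_diff M N = sym_diff M' N'" using *(1) by (auto simp: doubleton_eq_iff)
  then have "rotates F M N"
    using * periphery_boundary[OF *(5)] unfolding rotates_def by (auto simp: doubleton_eq_iff)
  then show "\<exists>F. rotates F M N" ..
next
  assume "\<exists>F. rotates F M N"
  then obtain F p where "perfect_matching G M" "perfect_matching G N" "F \<in> finite_faces G \<gamma>"
    "is_periphery G \<gamma> p F" "sym_diff M N = boundary F" unfolding rotates_def by blast
  then show "{M, N} \<in> edges (resonance_graph G \<gamma>)"
    using periphery_boundary[of p F] unfolding resonance_graph_def by auto
qed

lemma rotates_sym: "rotates F M N \<Longrightarrow> rotates F N M"
  unfolding rotates_def by (simp add: Un_commute)

lemma rotates_determines: "rotates F M N \<Longrightarrow> rotates F M N' \<Longrightarrow> N = N'"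
  unfolding rotates_def by blast

definition face_point :: "complex set \<Rightarrow> complex" where
  "face_point F = (SOME z. z \<in> F)"

lemma face_point:
  assumes "F \<in> finite_faces G \<gamma>"
  shows "face_point F \<in> F" "face_point F \<notin> D"
    "connected_component_set (- D) (face_point F) = F"
proof -
  show z: "face_point F \<in> F"
    unfolding face_point_def using finite_face(4)[OF assms] by (simp add: some_in_eq)
  then show "face_point F \<notin> D" using finite_face(5)[OF assms] by blast
  show "connected_component_set (- D) (face_point F) = F"
    using finite_face(6)[OF assms] z by (metis components_iff connected_component_eq)
qed

lemma rotates_height:
  assumes r: "rotates F M N" and E: "E \<in> finite_faces G \<gamma>"
  shows "height (face_point E) M = height (face_point E) N \<longleftrightarrow> E \<noteq> F"
proof -
  obtain p where p: "perfect_matching G M" "perfect_matching G N" "F \<in> finite_faces G \<gamma>"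
    "is_periphery G \<gamma> p F" "sym_diff M N = cycle_edges p"
    using r periphery_boundary unfolding rotates_def by metis
  note h = height_diff_face[OF p face_point(2)[OF E]]
  show ?thesis
  proof (cases "E = F")
    case True
    then show ?thesis using h(1) face_point(1)[OF E] by auto
  next
    case False
    then have "E \<inter> F = {}"
      using components_nonoverlap[OF finite_face(6)[OF E] finite_face(6)[OF p(3)]] by simp
    then show ?thesis using h(2) face_point(1)[OF E] False by blast
  qed
qed

lemma rotates_face_unique:
  assumes "rotates E M N" "rotates F M N"
  shows "E = F"
proof -
  have "E \<in> finite_faces G \<gamma>" using assms(1) unfolding rotates_def by blast
  then show ?thesis using rotates_height[OF assms(1)] rotates_height[OF assms(2)] by blast
qed

text \<open>The height above \<open>E\<close> changes at the first rotation of \<open>E\<close>, so it has to change back on the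
  remaining sides of the 4-cycle. This cannot happen on the side adjacent at \<open>M2\<close>, since rotating \<open>E\<close>
  twice in a row leads back to \<open>M\<close>.\<close>

lemma rotation_square:
  assumes "rotates F M M1" "rotates E M M2" "E \<noteq> F" "rotates E' M1 N" "rotates F' M2 N" "N \<noteq> M"
  shows "E' = E"
proof (rule ccontr)
  assume ne: "E' \<noteq> E"
  have E: "E \<in> finite_faces G \<gamma>" using assms(2) unfolding rotates_def by blast
  have "height (face_point E) M = height (face_point E) N"
    using rotates_height[OF assms(1) E] rotates_height[OF assms(4) E] assms(3) ne by simp
  moreover have "height (face_point E) M \<noteq> height (face_point E) M2"
    using rotates_height[OF assms(2) E] by simp
  ultimately have "F' = E" using rotates_height[OF assms(5) E] by auto
  then have "N = M"
    using rotates_determines[OF assms(5)] rotates_sym[OF assms(2)] by metis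
  then show False using assms(6) by blast
qed

lemma rotates_cycle:
  assumes "rotates F M N"
  obtains p where "is_cycle G p" "boundary F = cycle_edges p" "is_periphery G \<gamma> p F"
  using assms periphery_boundary unfolding rotates_def is_periphery_def by blast

lemma rotates_boundary_ne:
  assumes "rotates F M N"
  shows "\<Union>(boundary F) \<noteq> {}" "{} \<notin> boundary F"
proof -
  obtain p where p: "is_cycle G p" "boundary F = cycle_edges p" using rotates_cycle[OF assms] .
  show "\<Union>(boundary F) \<noteq> {}"
    unfolding p(2) Union_cycle_edges[OF p(1)] using p(1) by (auto simp: is_cycle_def)
  show "{} \<notin> boundary F" unfolding p(2) by (auto simp: cycle_edges_image)
qed

end


section \<open>Daisy cubes force commuting rotations\<close>

locale daisy_resonance = plane_elementary +
  fixes m :: "nat set \<Rightarrow> complex set set" and S :: "nat set set"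
  assumes family: "set_family_graph (resonance_graph G \<gamma>) m S"
    and down: "X \<in> S \<Longrightarrow> Y \<subseteq> X \<Longrightarrow> Y \<in> S"
    and finS: "X \<in> S \<Longrightarrow> finite X"
begin

abbreviation dual where "dual \<equiv> inner_dual G \<gamma>"

lemma matching_iff: "perfect_matching G M \<longleftrightarrow> (\<exists>X\<in>S. M = m X)"
proof -
  have "m ` S = {M. perfect_matching G M}"
    using family by (simp add: set_family_graph_def bij_betw_def resonance_graph_def)
  then show ?thesis by blast
qed

lemma m_inject: "X \<in> S \<Longrightarrow> Y \<in> S \<Longrightarrow> m X = m Y \<longleftrightarrow> X = Y"
  using family by (auto simp: set_family_graph_def bij_betw_def dest: inj_onD)

lemma rotates_iff: "X \<in> S \<Longrightarrow> Y \<in> S \<Longrightarrow> (\<exists>F. rotates F (m X) (m Y)) \<longleftrightarrow> card (sym_diff X Y) = 1"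
  using family unfolding set_family_graph_def resonance_edge_iff[symmetric] by blast

lemma empty_in_S: "{} \<in> S"
proof -
  obtain M where "perfect_matching G M" using elem by (auto simp: elementary_graph_def)
  then show ?thesis using matching_iff down by blast
qed

definition atoms :: "nat set" where
  "atoms = {i. {i} \<in> S}"

lemma subset_atoms: "X \<in> S \<Longrightarrow> X \<subseteq> atoms"
  using down by (auto simp: atoms_def)

lemma rotates_remove:
  assumes "X \<in> S" "i \<in> X"
  shows "\<exists>F. rotates F (m (X - {i})) (m X)"
proof -
  have "X - {i} \<in> S" using assms down by blast
  moreover have "sym_diff (X - {i}) X = {i}" using assms by blast
  ultimately show ?thesis using rotates_iff assms by simp
qed

definition face :: "nat \<Rightarrow> complex set" where
  "face i = (SOME F. rotates F (m {}) (m {i}))"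

lemma face_atom:
  assumes "i \<in> atoms"
  shows "rotates (face i) (m {}) (m {i})"
proof -
  have "\<exists>F. rotates F (m {}) (m {i})" using rotates_remove[of "{i}" i] assms by (simp add: atoms_def)
  then show ?thesis unfolding face_def by (rule someI_ex)
qed

lemma face_in: "i \<in> atoms \<Longrightarrow> face i \<in> finite_faces G \<gamma>"
  using face_atom unfolding rotates_def by blast

lemma face_inject:
  assumes "i \<in> atoms" "j \<in> atoms"
  shows "face i = face j \<longleftrightarrow> i = j"
proof
  assume eq: "face i = face j"
  have "m {i} = m {j}"
    by (rule rotates_determines[OF face_atom[OF assms(1)]]) (use face_atom[OF assms(2)] eq in simp)
  then show "i = j" using m_inject assms by (simp add: atoms_def)
qed simp

text \<open>Adding \<open>i\<close> to a set rotates the same face wherever it is done: this propagates from the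
  empty set through the 4-cycles of the cube.\<close>

lemma rotates_face:
  assumes "X \<in> S" "i \<in> X"
  shows "rotates (face i) (m (X - {i})) (m X)"
  using assms
proof (induction "card X" arbitrary: X i rule: less_induct)
  case less
  show ?case
  proof (cases "X = {i}")
    case True
    then show ?thesis using face_atom[of i] less.prems by (simp add: atoms_def)
  next
    case False
    then obtain j where j: "j \<in> X" "j \<noteq> i" using less.prems by blast
    let ?Z = "X - {i} - {j}"
    have S: "X - {i} \<in> S" "X - {j} \<in> S" "?Z \<in> S"
      by (rule down[OF less.prems(1)], blast)+
    have card: "card (X - {i}) < card X" "card (X - {j}) < card X"
      using card_Diff1_less[OF finS[OF less.prems(1)]] less.prems(2) j(1) by blast+
    have Z: "X - {j} - {i} = ?Z" by blast
    have r1: "rotates (face i) (m ?Z) (m (X - {j}))"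
      using less.hyps[OF card(2) S(2), of i] less.prems(2) j(2) unfolding Z by simp
    have r2: "rotates (face j) (m ?Z) (m (X - {i}))"
      using less.hyps[OF card(1) S(1), of j] j by simp
    obtain E where E: "rotates E (m (X - {i})) (m X)" using rotates_remove[OF less.prems] by blast
    obtain F where F: "rotates F (m (X - {j})) (m X)"
      using rotates_remove[OF less.prems(1) j(1)] by blast
    have "i \<in> atoms" "j \<in> atoms" using subset_atoms less.prems j by auto
    then have ne: "face i \<noteq> face j" using face_inject j(2) by simp
    have "X \<noteq> ?Z" using j(1) by blast
    then have "m X \<noteq> m ?Z" using m_inject less.prems(1) S(3) by simp
    from rotation_square[OF r2 r1 ne E F this] show ?thesis using E by simp
  qed
qed

text \<open>If the boundaries met, then by the square on \<open>{}\<close>, \<open>{i}\<close>, \<open>{j}\<close> and \<open>{i, j}\<close>, each of the two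
  boundaries would contain the other.\<close>

lemma faces_disjoint:
  assumes "{i, j} \<in> S" "i \<noteq> j"
  shows "\<Union>(boundary (face i)) \<inter> \<Union>(boundary (face j)) = {}"
proof (rule ccontr)
  assume "\<Union>(boundary (face i)) \<inter> \<Union>(boundary (face j)) \<noteq> {}"
  then obtain v where v: "v \<in> \<Union>(boundary (face i))" "v \<in> \<Union>(boundary (face j))" by blast
  have at: "i \<in> atoms" "j \<in> atoms" using subset_atoms[OF assms(1)] by auto
  have d: "{i, j} - {i} = {j}" "{i, j} - {j} = {i}" using assms(2) by auto
  have ri: "rotates (face i) (m {j}) (m {i, j})" using rotates_face[OF assms(1), of i] d by simp
  have rj: "rotates (face j) (m {i}) (m {i, j})" using rotates_face[OF assms(1), of j] d by simp
  note r0 = face_atom[OF at(1)] face_atom[OF at(2)]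
  obtain p where p: "is_cycle G p" "boundary (face i) = cycle_edges p" using rotates_cycle[OF r0(1)] .
  obtain q where q: "is_cycle G q" "boundary (face j) = cycle_edges q" using rotates_cycle[OF r0(2)] .
  note R = r0[unfolded rotates_def] ri[unfolded rotates_def] rj[unfolded rotates_def]
  have "cycle_edges p \<subseteq> boundary (face j)"
    by (rule commuting_rotations_subset[of "m {}" "m {i}" "m {j}" "m {i, j}"])
      (use R p v in auto)
  moreover have "cycle_edges q \<subseteq> boundary (face i)"
    by (rule commuting_rotations_subset[of "m {}" "m {j}" "m {i}" "m {i, j}"])
      (use R q v in auto)
  ultimately have "boundary (face i) = boundary (face j)" using p q by simp
  then have "face i = face j" using boundary_inject R by blast
  then show False using face_inject[OF at] assms(2) by simp
qed

lemma matching_eq: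
  assumes "X \<in> S"
  shows "m X = sym_diff (m {}) (\<Union>i\<in>X. boundary (face i))"
  using finS[OF assms] assms
proof (induction X)
  case (insert i X)
  have XS: "X \<in> S" by (rule down[OF insert.prems]) blast
  let ?U = "\<Union>j\<in>X. boundary (face j)"
  have "insert i X - {i} = X" using insert.hyps(2) by simp
  then have "sym_diff (m X) (m (insert i X)) = boundary (face i)"
    using rotates_face[OF insert.prems, of i] unfolding rotates_def by simp
  then have mX: "m (insert i X) = sym_diff (m X) (boundary (face i))" by blast
  have "boundary (face i) \<inter> boundary (face j) = {}" if j: "j \<in> X" for j
  proof -
    have "{i, j} \<in> S" "i \<noteq> j" using insert j down[of "insert i X" "{i, j}"] by auto
    from faces_disjoint[OF this] have "e = {}" if "e \<in> boundary (face i)" "e \<in> boundary (face j)" for e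
      using that by blast
    moreover have "i \<in> atoms" using subset_atoms[OF insert.prems] by simp
    ultimately show ?thesis using rotates_boundary_ne(2)[OF face_atom] by blast
  qed
  then have "boundary (face i) \<inter> ?U = {}" by blast
  then show ?case unfolding mX insert.IH[OF XS] by blast
qed simp

text \<open>If a face were never rotated, its height function would be constant, like that of a point far
  away, and the face would be unbounded.\<close>

lemma faces_are_atoms: "finite_faces G \<gamma> = face ` atoms"
proof (intro equalityI subsetI)
  show "F \<in> finite_faces G \<gamma>" if "F \<in> face ` atoms" for F using that face_in by blast
  fix F assume F: "F \<in> finite_faces G \<gamma>"
  show "F \<in> face ` atoms"
  proof (rule ccontr)
    assume no: "F \<notin> face ` atoms"
    have const: "height (face_point F) (m X) = height (face_point F) (m {})" if "X \<in> S" for X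
      using finS[OF that] that
    proof (induction X)
      case (insert i X)
      have "X \<in> S" "i \<in> atoms"
        using down[OF insert.prems, of X] subset_atoms[OF insert.prems] by auto
      moreover have "rotates (face i) (m X) (m (insert i X))"
        using rotates_face[OF insert.prems, of i] insert.hyps(2) by simp
      ultimately show ?case using rotates_height[OF _ F] insert.IH no by force
    qed simp
    obtain b where b: "b \<notin> D" "\<And>F. F \<in> finite_faces G \<gamma> \<Longrightarrow> b \<notin> F"
      "\<And>M N p. perfect_matching G M \<Longrightarrow> perfect_matching G N \<Longrightarrow> is_cycle G p \<Longrightarrow>
        sym_diff M N = cycle_edges p \<Longrightarrow> height b M = height b N"
      using that by (rule height_far)
    have M0: "perfect_matching G (m {})" using matching_iff empty_in_S by blast
    have "connected_component (- D) (face_point F) b"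
    proof (rule same_height_imp_connected[OF face_point(2)[OF F] b(1) M0])
      fix N p assume N: "perfect_matching G N" "is_cycle G p" "sym_diff N (m {}) = cycle_edges p"
      obtain X where "X \<in> S" "N = m X" using N(1) matching_iff by blast
      then show "height (face_point F) N - height (face_point F) (m {}) = height b N - height b (m {})"
        using const b(3)[OF N(1) M0 N(2,3)] by simp
    qed
    then have "b \<in> F" using face_point(3)[OF F] by blast
    then show False using b(2)[OF F] by blast
  qed
qed

lemma face_periphery:
  assumes "F \<in> finite_faces G \<gamma>"
  obtains p where "is_cycle G p" "boundary F = cycle_edges p" "is_periphery G \<gamma> p F"
proof -
  obtain i where "i \<in> atoms" "F = face i" using assms faces_are_atoms by blast
  then show thesis using that rotates_cycle[OF face_atom] by metis
qed

lemma base_matching: "perfect_matching G (m {})"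
  using matching_iff empty_in_S by blast

text \<open>All finite faces are alternating for the matching of the empty set. Its edge at a vertex of a
  face thus lies on this face; so faces that meet in a vertex share an edge, and no vertex lies on
  three faces.\<close>

lemma base_edge_in_boundary:
  assumes F: "F \<in> finite_faces G \<gamma>" and "v \<in> \<Union>(boundary F)" "e \<in> m {}" "v \<in> e"
  shows "e \<in> boundary F"
proof -
  obtain i where i: "i \<in> atoms" "F = face i" using assms faces_are_atoms by blast
  note r = face_atom[OF i(1), folded i(2), unfolded rotates_def]
  show ?thesis using matched_in_sym_diff[of "m {}" "m {i}" v e] r assms by simp
qed

lemma shared_vertex_imp_shared_edge:
  assumes "E \<in> finite_faces G \<gamma>" "F \<in> finite_faces G \<gamma>" "v \<in> \<Union>(boundary E)" "v \<in> \<Union>(boundary F)"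
  obtains e where "e \<in> m {}" "v \<in> e" "e \<in> boundary E" "e \<in> boundary F"
proof -
  have "v \<in> verts G" using assms(3) edge_subset_verts unfolding boundary_def by blast
  then obtain e where "e \<in> m {}" "v \<in> e" using matching_covers[OF base_matching] by blast
  then show thesis using that base_edge_in_boundary assms by blast
qed

lemma dual_edge_iff:
  assumes "E \<in> finite_faces G \<gamma>" "F \<in> finite_faces G \<gamma>"
  shows "{E, F} \<in> edges dual \<longleftrightarrow> E \<noteq> F \<and> \<Union>(boundary E) \<inter> \<Union>(boundary F) \<noteq> {}"
proof -
  have "{E, F} \<in> edges dual \<longleftrightarrow> E \<noteq> F \<and> boundary E \<inter> boundary F \<noteq> {}"
    using assms by (auto simp: inner_dual_def boundary_def doubleton_eq_iff)
  moreover have "boundary E \<inter> boundary F \<noteq> {} \<longleftrightarrow> \<Union>(boundary E) \<inter> \<Union>(boundary F) \<noteq> {}"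
  proof
    assume "boundary E \<inter> boundary F \<noteq> {}"
    then obtain e where e: "e \<in> boundary E" "e \<in> boundary F" by blast
    then obtain a where "a \<in> e" using bip[of e] unfolding boundary_def by blast
    with e show "\<Union>(boundary E) \<inter> \<Union>(boundary F) \<noteq> {}" by blast
  next
    assume "\<Union>(boundary E) \<inter> \<Union>(boundary F) \<noteq> {}"
    then show "boundary E \<inter> boundary F \<noteq> {}"
      using shared_vertex_imp_shared_edge[OF assms] by blast
  qed
  ultimately show ?thesis by simp
qed

lemma finite_atoms: "finite atoms"
proof (rule finite_imageD[of face])
  show "finite (face ` atoms)" using finite_finite_faces faces_are_atoms by simp
  show "inj_on face atoms" using face_inject by (simp add: inj_on_def)
qed

text \<open>Faces that are pairwise not adjacent have disjoint boundaries, so they can be rotated one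
  after the other.\<close>

lemma independent_imp_family:
  assumes "finite X" "X \<subseteq> atoms" "independent_set dual (face ` X)"
  shows "X \<in> S"
  using assms
proof (induction X)
  case empty
  show ?case by (rule empty_in_S)
next
  case (insert i X)
  have i: "i \<in> atoms" and X: "X \<subseteq> atoms" using insert.prems by auto
  have XS: "X \<in> S"
    by (rule insert.IH[OF X]) (rule independent_subset[OF insert.prems(2)], blast)
  define U where "U = (\<Union>j\<in>X. boundary (face j))"
  note r = face_atom[OF i, unfolded rotates_def]
  have sd: "sym_diff (m {}) (m {i}) = boundary (face i)" using r by blast
  have "\<Union>(boundary (face j)) \<inter> \<Union>(boundary (face i)) = {}" if j: "j \<in> X" for j
  proof -
    have "j \<in> atoms" "j \<noteq> i" using j X insert.hyps(2) by auto
    then have "face j \<noteq> face i" using face_inject i by simp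
    moreover have "{face j, face i} \<notin> edges dual"
      using insert.prems(2) j unfolding independent_set_def by blast
    ultimately show ?thesis using dual_edge_iff[OF face_in face_in] \<open>j \<in> atoms\<close> i by blast
  qed
  then have disj: "\<Union>U \<inter> \<Union>(sym_diff (m {}) (m {i})) = {}" unfolding sd U_def by blast
  define N where "N = sym_diff (m X) (boundary (face i))"
  have mX: "perfect_matching G (m X)" using matching_iff XS by blast
  have N: "perfect_matching G N"
    unfolding N_def sd[symmetric]
    by (rule matching_rotate_disjoint[OF base_matching _ mX _ disj])
      (use r matching_eq[OF XS] in \<open>simp_all add: U_def\<close>)
  have "sym_diff (m X) N = boundary (face i)" unfolding N_def by blast
  then have rN: "rotates (face i) (m X) N" using r mX N unfolding rotates_def by blast
  obtain C where C: "C \<in> S" "N = m C" using N matching_iff by blast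
  then have "card (sym_diff X C) = 1" using rotates_iff[OF XS C(1)] rN by blast
  then obtain j where j: "sym_diff X C = {j}" by (rule card_1_singletonE)
  have diff: "x \<in> X \<and> x \<notin> C \<or> x \<in> C \<and> x \<notin> X \<longleftrightarrow> x = j" for x
    using arg_cong[OF j, of "\<lambda>K. x \<in> K"] by simp
  have "j \<in> X \<or> j \<in> C" using diff[of j] by blast
  then have at: "j \<in> atoms" using subset_atoms[OF XS] subset_atoms[OF C(1)] by auto
  show ?case
  proof (cases "j \<in> C")
    case True
    have XC: "X = C - {j}"
    proof (rule set_eqI)
      show "x \<in> X \<longleftrightarrow> x \<in> C - {j}" for x using diff[of x] diff[of j] True by blast
    qed
    then have "rotates (face j) (m X) N" using rotates_face[OF C(1) True] by (simp only: C(2) XC)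
    then have "j = i" using rotates_face_unique[OF _ rN] face_inject[OF at i] by simp
    then have "insert i X = C" using XC True by auto
    then show ?thesis using C(1) by simp
  next
    case False
    then have jX: "j \<in> X" using \<open>j \<in> X \<or> j \<in> C\<close> by blast
    have CX: "C = X - {j}"
    proof (rule set_eqI)
      show "x \<in> C \<longleftrightarrow> x \<in> X - {j}" for x using diff[of x] diff[of j] False by blast
    qed
    then have "rotates (face j) N (m X)" using rotates_face[OF XS jX] by (simp only: C(2) CX)
    then have "j = i"
      using rotates_face_unique[OF rotates_sym rN] face_inject[OF at i] by simp
    then show ?thesis using jX insert.hyps(2) by simp
  qed
qed

lemma family_imp_independent:
  assumes X: "X \<in> S"
  shows "independent_set dual (face ` X)"
proof -
  have at: "X \<subseteq> atoms" by (rule subset_atoms[OF X])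
  have "{face i, face j} \<notin> edges dual" if ij: "i \<in> X" "j \<in> X" for i j
  proof (cases "i = j")
    case True
    then show ?thesis by (auto simp: inner_dual_def doubleton_eq_iff)
  next
    case False
    have "{i, j} \<in> S" by (rule down[OF X]) (use ij in blast)
    moreover have "face i \<in> finite_faces G \<gamma>" "face j \<in> finite_faces G \<gamma>"
      using at ij face_in by auto
    ultimately show ?thesis using faces_disjoint[OF _ False] dual_edge_iff by blast
  qed
  moreover have "face ` X \<subseteq> verts dual" using at face_in by (auto simp: inner_dual_def)
  ultimately show ?thesis unfolding independent_set_def by blast
qed

theorem resonance_iso_DI: "graph_iso (resonance_graph G \<gamma>) (DI dual)"
proof -
  have "finite (verts dual)" using finite_finite_faces by (simp add: inner_dual_def)
  then obtain f where f: "set_family_graph (DI dual) f {I. independent_set dual I}"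
    by (rule DI_set_family)
  have inj: "inj_on face atoms" using face_inject by (simp add: inj_on_def)
  have "bij_betw ((`) face) S {I. independent_set dual I}"
  proof (rule bij_betw_imageI)
    show "inj_on ((`) face) S"
      using inj_on_image_Pow[OF inj] subset_atoms by (auto simp: inj_on_def)
    show "(`) face ` S = {I. independent_set dual I}"
    proof (intro equalityI subsetI)
      fix I assume "I \<in> {I. independent_set dual I}"
      then have I: "independent_set dual I" by simp
      then have "I \<subseteq> face ` atoms"
        using faces_are_atoms by (simp add: independent_set_def inner_dual_def)
      then obtain X where X: "X \<subseteq> atoms" "I = face ` X" by (rule subset_imageE)
      then have "X \<in> S"
        using independent_imp_family[OF finite_subset[OF X(1) finite_atoms] X(1)] I by simp
      with X(2) show "I \<in> (`) face ` S" by blast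
    qed (auto intro: family_imp_independent)
  qed
  moreover have "card (sym_diff (face ` X) (face ` Y)) = 1 \<longleftrightarrow> card (sym_diff X Y) = 1"
    if "X \<in> S" "Y \<in> S" for X Y
  proof -
    have at: "X \<subseteq> atoms" "Y \<subseteq> atoms" using subset_atoms that by auto
    have "sym_diff (face ` X) (face ` Y) = face ` sym_diff X Y"
      using inj_on_image_set_diff[OF inj, of X Y] inj_on_image_set_diff[OF inj, of Y X] at
        subset_trans[OF Diff_subset at(1)] subset_trans[OF Diff_subset at(2)]
      by (simp add: image_Un)
    moreover have "inj_on face (sym_diff X Y)" using inj at by (auto intro: inj_on_subset)
    ultimately show ?thesis by (simp add: card_image)
  qed
  ultimately show ?thesis by (rule set_family_iso[OF family f])
qed


section \<open>The inner dual is a tree\<close>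

lemma base_edge_two_faces:
  assumes "F \<in> finite_faces G \<gamma>" "X \<in> finite_faces G \<gamma>" "Y \<in> finite_faces G \<gamma>"
    and "v \<in> \<Union>(boundary F)" "v \<in> \<Union>(boundary X)" "v \<in> \<Union>(boundary Y)"
    and "X \<noteq> F" "Y \<noteq> F"
  shows "X = Y"
proof -
  obtain e where e: "e \<in> m {}" "v \<in> e" "e \<in> boundary F" "e \<in> boundary X"
    using shared_vertex_imp_shared_edge[OF assms(1,2,4,5)] .
  have "e \<in> boundary Y" by (rule base_edge_in_boundary[OF assms(3,6) e(1,2)])
  moreover obtain p where "is_periphery G \<gamma> p F" using face_periphery[OF assms(1)] by metis
  ultimately show ?thesis using edge_on_two_faces assms e by blast
qed

text \<open>Walk through \<open>G\<close> along allowed edges. An edge of the matching of the empty set stays on every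
  face that it touches, and any other allowed edge runs along some \<open>face i\<close>; where the face changes,
  the old and the new face meet in a vertex.\<close>

lemma dual_connected:
  assumes E: "E \<in> finite_faces G \<gamma>" and F: "F \<in> finite_faces G \<gamma>"
  shows "(E, F) \<in> {(X, Y). {X, Y} \<in> edges dual}\<^sup>*"
proof -
  let ?R = "{(X, Y). {X, Y} \<in> edges dual}\<^sup>*"
  define P where "P v \<longleftrightarrow> (\<forall>X\<in>finite_faces G \<gamma>. v \<in> \<Union>(boundary X) \<longrightarrow> (E, X) \<in> ?R)" for v
  have meet: "(E, Y) \<in> ?R"
    if "(E, X) \<in> ?R" "X \<in> finite_faces G \<gamma>" "Y \<in> finite_faces G \<gamma>"
      "v \<in> \<Union>(boundary X)" "v \<in> \<Union>(boundary Y)" for X Y v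
  proof (cases "X = Y")
    case False
    then have "{X, Y} \<in> edges dual" using dual_edge_iff that by blast
    then show ?thesis using that(1) by (auto intro: rtrancl_into_rtrancl)
  qed (use that in simp)
  have nonempty: "\<exists>v. v \<in> \<Union>(boundary X)" if X: "X \<in> finite_faces G \<gamma>" for X
  proof -
    obtain i where i: "i \<in> atoms" "X = face i" using X faces_are_atoms by blast
    then show ?thesis using rotates_boundary_ne(1)[OF face_atom[OF i(1)]] by auto
  qed
  have vG: "v \<in> verts G" if "v \<in> \<Union>(boundary X)" for v X
    using that edge_subset_verts by (auto simp: boundary_def)
  obtain u where u: "u \<in> \<Union>(boundary E)" using nonempty[OF E] by blast
  obtain v where v: "v \<in> \<Union>(boundary F)" using nonempty[OF F] by blast
  have "P v"
  proof (rule allowed_edge_connected[OF vG[OF u] vG[OF v]])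
    show "P u" unfolding P_def using meet[OF rtrancl.rtrancl_refl E _ u] by blast
    fix x y assume xy: "{x, y} \<in> allowed_edges G" "P x"
    obtain M where M: "perfect_matching G M" "{x, y} \<in> M" using xy(1) by (auto simp: allowed_edges_def)
    obtain C where C: "C \<in> S" "M = m C" using M(1) matching_iff by blast
    have cases: "{x, y} \<in> m {} \<or> (\<exists>i\<in>C. {x, y} \<in> boundary (face i))"
      using M(2) matching_eq[OF C(1)] C(2) by blast
    show "P y"
      unfolding P_def
    proof (intro ballI impI)
      fix X assume X: "X \<in> finite_faces G \<gamma>" "y \<in> \<Union>(boundary X)"
      from cases show "(E, X) \<in> ?R"
      proof (elim disjE bexE)
        assume "{x, y} \<in> m {}"
        then have "{x, y} \<in> boundary X" by (rule base_edge_in_boundary[OF X]) simp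
        then have "x \<in> \<Union>(boundary X)" by blast
        then show ?thesis using xy(2) X(1) unfolding P_def by blast
      next
        fix i assume i: "i \<in> C" "{x, y} \<in> boundary (face i)"
        have Fi: "face i \<in> finite_faces G \<gamma>" using face_in subset_atoms[OF C(1)] i(1) by blast
        have "x \<in> \<Union>(boundary (face i))" "y \<in> \<Union>(boundary (face i))" using i(2) by blast+
        then show ?thesis using meet[OF _ Fi X(1) _ X(2)] xy(2) Fi unfolding P_def by blast
      qed
    qed
  qed
  then show ?thesis using F v unfolding P_def by blast
qed

text \<open>Let \<open>T\<close> be the set of vertices that \<open>F\<close> shares with \<open>X\<close>. An edge of \<open>F\<close> with only one end in
  \<open>T\<close> lies on no other face: such a face would meet \<open>F\<close> and \<open>X\<close> in one vertex, so it would be \<open>X\<close>.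
  Hence a perfect matching contains all of these edges or none of them, and as many of them are
  directed into \<open>T\<close> as out of it, since \<open>T\<close> has as many vertices in \<open>A\<close> as in \<open>B\<close>. So they form
  a matching-invariant weight, whose potential is the indicator of \<open>T\<close> along \<open>F\<close>.\<close>

lemma cut_potential:
  assumes F: "F \<in> finite_faces G \<gamma>" and X: "X \<in> finite_faces G \<gamma>" "X \<noteq> F"
  shows "\<exists>(\<pi> :: complex \<Rightarrow> int) c.
    (\<forall>v \<in> \<Union>(boundary F). \<pi> v = c + of_bool (v \<in> \<Union>(boundary X))) \<and>
    (\<forall>Y \<in> finite_faces G \<gamma> - {F}. \<forall>u \<in> \<Union>(boundary Y). \<forall>v \<in> \<Union>(boundary Y). \<pi> u = \<pi> v)"
proof -
  define T where "T = \<Union>(boundary F) \<inter> \<Union>(boundary X)"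
  obtain i where i: "i \<in> atoms" "F = face i" using F faces_are_atoms by blast
  note r = face_atom[OF i(1), folded i(2), unfolded rotates_def]
  have sd: "sym_diff (m {}) (m {i}) = boundary F" and PM1: "perfect_matching G (m {i})" using r by blast+
  \<comment> \<open>1 for an edge directed into \<open>T\<close>, -1 for one out of \<open>T\<close>, and 0 for the others\<close>
  define s where "s e = int (card (e \<inter> (T \<inter> B))) - int (card (e \<inter> (T \<inter> A)))" for e
  define w where "w e = (if e \<in> boundary F then s e else 0)" for e
  have s: "s {a, b} = of_bool (b \<in> T) - of_bool (a \<in> T)" if "a \<in> A" "b \<in> B" for a b
  proof -
    have "{a, b} \<inter> (T \<inter> B) = (if b \<in> T then {b} else {})"
      "{a, b} \<inter> (T \<inter> A) = (if a \<in> T then {a} else {})" using that parts by auto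
    then show ?thesis by (simp add: s_def)
  qed
  have TV: "T \<subseteq> verts G" using edge_subset_verts by (auto simp: T_def boundary_def)
  have s_base: "s e = 0" if e: "e \<in> m {}" for e
  proof -
    obtain a b where ab: "a \<in> A" "b \<in> B" "e = {a, b}"
      using bip[of e] matching_edges[OF base_matching] e by blast
    have "v \<in> T \<Longrightarrow> v \<in> e \<Longrightarrow> e \<subseteq> T" for v
      unfolding T_def
      using base_edge_in_boundary[OF F _ e, of v] base_edge_in_boundary[OF X(1) _ e, of v] by blast
    then have "a \<in> T \<longleftrightarrow> b \<in> T" using ab(3) by blast
    then show ?thesis using s[OF ab(1,2)] ab(3) by simp
  qed
  have only_F: "e \<notin> boundary Y" if e: "e \<in> boundary F" "s e \<noteq> 0" and Y: "Y \<in> finite_faces G \<gamma>" "Y \<noteq> F" for e Y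
  proof
    assume eY: "e \<in> boundary Y"
    obtain a b where ab: "a \<in> A" "b \<in> B" "e = {a, b}" using bip[of e] e(1) by (auto simp: boundary_def)
    then have "(a \<in> T) \<noteq> (b \<in> T)" using s[OF ab(1,2)] e(2) by (auto split: if_splits)
    then obtain t where t: "t \<in> e" "t \<in> T" "\<not> e \<subseteq> T" using ab(3) by blast
    have "X = Y"
      by (rule base_edge_two_faces[OF F X(1) Y(1), of t]) (use t e(1) eY X(2) Y(2) in \<open>auto simp: T_def\<close>)
    then have "e \<subseteq> T" using eY e(1) by (auto simp: T_def)
    then show False using t(3) by blast
  qed
  have total: "sum w M = int (card (T \<inter> B)) - int (card (T \<inter> A))"
    if M: "perfect_matching G M" "perfect_matching G N" "sym_diff M N = boundary F" for M N
  proof -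
    have "w e = s e" if e: "e \<in> M" for e
    proof (cases "e \<in> boundary F")
      case False
      have "e \<inter> T = {}"
      proof (rule ccontr)
        assume "e \<inter> T \<noteq> {}"
        then obtain v where "v \<in> e" "v \<in> \<Union>(boundary F)" by (auto simp: T_def)
        then show False using matched_in_sym_diff[OF M(1,2) _ e] M(3) False by blast
      qed
      then have "e \<inter> (T \<inter> B) = {}" "e \<inter> (T \<inter> A) = {}" by blast+
      then show ?thesis using False by (simp add: w_def s_def)
    qed (simp add: w_def)
    then have "sum w M = sum s M" by simp
    also have "\<dots> = int (\<Sum>e\<in>M. card (e \<inter> (T \<inter> B))) - int (\<Sum>e\<in>M. card (e \<inter> (T \<inter> A)))"
      by (simp add: s_def sum_subtractf)
    also have "\<dots> = int (card (T \<inter> B)) - int (card (T \<inter> A))"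
    proof -
      have "T \<inter> B \<subseteq> verts G" "T \<inter> A \<subseteq> verts G" using TV by blast+
      from sum_card_Int_matching[OF M(1) this(1)] sum_card_Int_matching[OF M(1) this(2)]
      show ?thesis by simp
    qed
    finally show ?thesis .
  qed
  have w_base: "w e = 0" if "e \<in> m {}" for e using s_base[OF that] by (simp add: w_def)
  have "sum w (m {}) = sum w (m {i})"
    using total[OF base_matching PM1 sd] total[OF PM1 base_matching] sd by (simp add: Un_commute)
  then have zero: "sum w (m {i}) = 0" using w_base by simp
  \<comment> \<open>whether \<open>N\<close> contains these edges is decided by \<open>i \<in> C\<close>, and their total weight is 0\<close>
  have inv: "sum w N = sum w (m {})" if N: "perfect_matching G N" for N
  proof -
    obtain C where C: "C \<in> S" "N = m C" using N matching_iff by blast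
    note mC = matching_eq[OF C(1)]
    have finN: "finite N" using N by (rule finite_matching)
    have at: "C \<subseteq> atoms" by (rule subset_atoms[OF C(1)])
    have off: "w e = 0" if e: "e \<in> N" "e \<notin> boundary F - m {}" for e
    proof -
      consider "e \<in> m {}" | "e \<notin> boundary F" using e by blast
      then show ?thesis using w_base by cases (auto simp: w_def)
    qed
    show ?thesis
    proof (cases "i \<in> C")
      case True
      have "boundary F \<subseteq> (\<Union>j\<in>C. boundary (face j))" using True i(2) by blast
      then have sub: "boundary F - m {} \<subseteq> N" unfolding C(2) mC by blast
      have "sum w N = sum w (boundary F - m {})"
        by (rule sum.mono_neutral_right[OF finN sub]) (use off in blast)
      also have "boundary F - m {} = m {i} - m {}" using sd by blast
      also have "sum w (m {i} - m {}) = sum w (m {i})"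
        by (rule sum.mono_neutral_left[OF finite_matching[OF PM1]]) (use w_base in auto)
      finally show ?thesis using zero w_base by simp
    next
      case False
      have "w e = 0" if e: "e \<in> N" for e
      proof (rule ccontr)
        assume nz: "w e \<noteq> 0"
        then have eF: "e \<in> boundary F" "s e \<noteq> 0" by (auto simp: w_def split: if_splits)
        have "e \<notin> m {}" using nz w_base by blast
        then obtain j where j: "j \<in> C" "e \<in> boundary (face j)" using e C(2) mC by blast
        have "j \<in> atoms" "j \<noteq> i" using j(1) at False by auto
        then show False using only_F[OF eF face_in] j(2) face_inject i by simp
      qed
      then show ?thesis using w_base by simp
    qed
  qed
  obtain \<pi> where pi: "\<And>a b. a \<in> A \<Longrightarrow> b \<in> B \<Longrightarrow> {a, b} \<in> edges G \<Longrightarrow> w {a, b} = \<pi> b - \<pi> a"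
    using potential_of_matching_invariant[OF base_matching, of w] inv by metis
  have pi_diff: "\<pi> x = \<pi> y" if xy: "{x, y} \<in> edges G" "w {x, y} = 0" for x y
  proof -
    obtain a b where ab: "a \<in> A" "b \<in> B" "{x, y} = {a, b}" using bip[OF xy(1)] by blast
    have "\<pi> a = \<pi> b" using pi[OF ab(1,2)] xy ab(3) by simp
    moreover have "x = a \<and> y = b \<or> x = b \<and> y = a" using ab(3) by (simp only: doubleton_eq_iff)
    ultimately show ?thesis by auto
  qed
  have pi_F: "\<pi> x - of_bool (x \<in> T) = \<pi> y - of_bool (y \<in> T)" if xy: "{x, y} \<in> boundary F" for x y
  proof -
    have e: "{x, y} \<in> edges G" using xy by (simp add: boundary_def)
    obtain a b where ab: "a \<in> A" "b \<in> B" "{x, y} = {a, b}" using bip[OF e] by blast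
    have "\<pi> b - \<pi> a = of_bool (b \<in> T) - of_bool (a \<in> T)"
      using pi[OF ab(1,2)] s[OF ab(1,2)] e xy ab(3) by (simp add: w_def)
    moreover have "x = a \<and> y = b \<or> x = b \<and> y = a" using ab(3) by (simp only: doubleton_eq_iff)
    ultimately show ?thesis by (elim disjE conjE) simp_all
  qed
  obtain p where p: "is_cycle G p" "boundary F = cycle_edges p" using face_periphery[OF F] by metis
  obtain u where u: "u \<in> set p" using p(1) by (cases p) (auto simp: is_cycle_def)
  define c where "c = \<pi> u - of_bool (u \<in> T)"
  have "\<pi> v = c + of_bool (v \<in> \<Union>(boundary X))" if vF: "v \<in> \<Union>(boundary F)" for v
  proof -
    have v: "v \<in> set p" using vF unfolding p(2) Union_cycle_edges[OF p(1)] .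
    have "\<pi> v - of_bool (v \<in> T) = c"
      by (rule cycle_induct_connected[OF p(1) u, where P = "\<lambda>v. \<pi> v - of_bool (v \<in> T) = c"])
        (use c_def pi_F p(2) v in auto)
    moreover have "v \<in> T \<longleftrightarrow> v \<in> \<Union>(boundary X)" using vF unfolding T_def by blast
    ultimately show ?thesis by simp
  qed
  moreover have "\<pi> x = \<pi> y"
    if Y: "Y \<in> finite_faces G \<gamma>" "Y \<noteq> F" and xy: "x \<in> \<Union>(boundary Y)" "y \<in> \<Union>(boundary Y)" for Y x y
  proof -
    obtain q where q: "is_cycle G q" "boundary Y = cycle_edges q" using face_periphery[OF Y(1)] by metis
    have xy': "x \<in> set q" "y \<in> set q" using xy unfolding q(2) Union_cycle_edges[OF q(1)] .
    have "\<pi> y = \<pi> x"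
    proof (rule cycle_induct_connected[OF q(1) xy'(1), where P = "\<lambda>v. \<pi> v = \<pi> x"])
      fix g h assume gh: "{g, h} \<in> cycle_edges q" "\<pi> g = \<pi> x"
      then have Yg: "{g, h} \<in> boundary Y" using q(2) by simp
      have "w {g, h} = 0" using only_F[OF _ _ Y, of "{g, h}"] Yg by (auto simp: w_def)
      moreover have "{g, h} \<in> edges G" using Yg by (simp add: boundary_def)
      ultimately show "\<pi> h = \<pi> x" using pi_diff gh(2) by metis
    qed (use xy' in auto)
    then show ?thesis by simp
  qed
  ultimately show ?thesis by blast
qed

text \<open>A cycle of the inner dual through \<open>F\<close> leads from \<open>X\<close> to \<open>Y\<close> over faces other than \<open>F\<close>.
  Along it the cut potential of \<open>F\<close> and \<open>X\<close> keeps its value, but it takes different values at the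
  vertices that \<open>F\<close> shares with \<open>X\<close> and with \<open>Y\<close>, since no vertex lies on all three faces.\<close>

lemma dual_acyclic: "\<not> is_cycle dual q"
proof
  assume q: "is_cycle dual q"
  define n where "n = length q"
  have n: "3 \<le> n" using q by (simp add: is_cycle_def n_def)
  have face: "q ! j \<in> finite_faces G \<gamma>" if "j < n" for j
    using q that by (auto simp: is_cycle_def n_def inner_dual_def)
  have eq: "q ! j = q ! k \<longleftrightarrow> j = k" if "j < n" "k < n" for j k
    using q that by (simp add: is_cycle_def n_def nth_eq_iff_index_eq)
  have meet: "\<exists>v. v \<in> \<Union>(boundary (q ! j)) \<and> v \<in> \<Union>(boundary (q ! (Suc j mod n)))" if j: "j < n" for j
  proof -
    have "{q ! j, q ! (Suc j mod n)} \<in> edges dual"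
      using q j by (auto simp: is_cycle_def cycle_edges_image n_def)
    moreover have "Suc j mod n < n" using n by simp
    ultimately show ?thesis using dual_edge_iff[OF face face] j by blast
  qed
  let ?F = "q ! 0" and ?X = "q ! 1" and ?Y = "q ! (n - 1)"
  have ne: "?X \<noteq> ?F" "?Y \<noteq> ?F" "?X \<noteq> ?Y" using eq n by auto
  have faces: "?F \<in> finite_faces G \<gamma>" "?X \<in> finite_faces G \<gamma>" "?Y \<in> finite_faces G \<gamma>"
    using face n by auto
  obtain \<pi> :: "complex \<Rightarrow> int" and c where pi:
    "\<And>v. v \<in> \<Union>(boundary ?F) \<Longrightarrow> \<pi> v = c + of_bool (v \<in> \<Union>(boundary ?X))"
    "\<And>Y u v. Y \<in> finite_faces G \<gamma> \<Longrightarrow> Y \<noteq> ?F \<Longrightarrow> u \<in> \<Union>(boundary Y) \<Longrightarrow> v \<in> \<Union>(boundary Y) \<Longrightarrow>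
      \<pi> u = \<pi> v"
    using cut_potential[OF faces(1,2) ne(1)] by (metis Diff_iff singletonD)
  obtain x where x: "x \<in> \<Union>(boundary ?F)" "x \<in> \<Union>(boundary ?X)" using meet[of 0] n by auto
  obtain y where y: "y \<in> \<Union>(boundary ?Y)" "y \<in> \<Union>(boundary ?F)" using meet[of "n - 1"] n by auto
  have "y \<notin> \<Union>(boundary ?X)"
    using base_edge_two_faces[OF faces y(2) _ y(1) ne(1,2)] ne(3) by blast
  then have neq: "\<pi> x \<noteq> \<pi> y" using pi(1)[OF x(1)] pi(1)[OF y(2)] x by simp
  have const: "\<forall>v \<in> \<Union>(boundary (q ! Suc j)). \<pi> v = \<pi> x" if "Suc j < n" for j
    using that
  proof (induction j)
    case 0
    then show ?case using pi(2)[OF faces(2) ne(1) _ x(2)] by simp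
  next
    case (Suc j)
    obtain z where z: "z \<in> \<Union>(boundary (q ! Suc j))" "z \<in> \<Union>(boundary (q ! Suc (Suc j)))"
      using meet[of "Suc j"] Suc.prems by auto
    have "\<pi> z = \<pi> x" using Suc.IH Suc.prems z(1) by auto
    moreover have "q ! Suc (Suc j) \<noteq> ?F" using eq[of "Suc (Suc j)" 0] Suc.prems by simp
    ultimately show ?case using pi(2)[OF face[OF Suc.prems] _ _ z(2)] by metis
  qed
  have "\<pi> y = \<pi> x"
  proof -
    have "Suc (n - 2) = n - 1" "n - 1 < n" using n by auto
    then show ?thesis using const[of "n - 2"] y(1) by metis
  qed
  then show False using neq by simp
qed

theorem dual_tree: "tree_graph dual"
  using dual_connected dual_acyclic
  by (auto simp: tree_graph_def connected_graph_def inner_dual_def)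

end


section \<open>Resonance graphs that are daisy cubes\<close>

theorem lemma8:
  fixes G :: "complex ugraph" and \<gamma> :: "complex set \<Rightarrow> real \<Rightarrow> complex"
  assumes "plane_graph G \<gamma>" and "elementary_graph G" and "bipartite_graph G"
  shows "(daisy_cube (resonance_graph G \<gamma>) \<longleftrightarrow>
            tree_graph (inner_dual G \<gamma>) \<and>
            graph_iso (resonance_graph G \<gamma>) (DI (inner_dual G \<gamma>))) \<and>
         (graph_iso (resonance_graph G \<gamma>) (DI (inner_dual G \<gamma>)) \<longleftrightarrow>
            graph_iso (resonance_graph G \<gamma>)
              (simplex_graph (complement_graph (inner_dual G \<gamma>))))"
proof -
  let ?R = "resonance_graph G \<gamma>" and ?H = "inner_dual G \<gamma>"
  obtain A B where AB: "A \<union> B = verts G" "A \<inter> B = {}"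
    "\<forall>e\<in>edges G. \<exists>a\<in>A. \<exists>b\<in>B. e = {a, b}"
    using assms(3) unfolding bipartite_graph_def by (elim exE conjE)
  interpret plane_elementary G A B \<gamma>
  proof unfold_locales
    show "fin_graph G" using assms(1) by (simp add: plane_graph_def)
    show "\<exists>a\<in>A. \<exists>b\<in>B. e = {a, b}" if "e \<in> edges G" for e using AB(3) that by (rule bspec)
  qed (fact AB assms)+
  have "finite (verts ?H)" using finite_finite_faces by (simp add: inner_dual_def)
  moreover have "{F} \<notin> edges ?H" for F by (auto simp: inner_dual_def doubleton_eq_iff)
  ultimately have DK: "graph_iso (DI ?H) (simplex_graph (complement_graph ?H))"
    by (rule DI_iso_simplex)
  have "tree_graph ?H \<and> graph_iso ?R (DI ?H)" if daisy: "daisy_cube ?R"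
  proof -
    obtain m :: "nat set \<Rightarrow> complex set set" and S where
      "set_family_graph ?R m S" "\<And>X Y. X \<in> S \<Longrightarrow> Y \<subseteq> X \<Longrightarrow> Y \<in> S" "\<And>X. X \<in> S \<Longrightarrow> finite X"
      using that by (rule daisy_cube_set_family[OF daisy])
    then interpret daisy_resonance G A B \<gamma> m S by unfold_locales
    show ?thesis using dual_tree resonance_iso_DI by blast
  qed
  moreover have "daisy_cube ?R" if "graph_iso ?R (DI ?H)"
    using that by (rule daisy_cube_DI)
  moreover have "graph_iso ?R (DI ?H) \<longleftrightarrow> graph_iso ?R (simplex_graph (complement_graph ?H))"
    using graph_iso_trans[OF _ DK] graph_iso_trans[OF _ graph_iso_sym[OF DK]] by (rule iffI)
  ultimately show ?thesis by (intro conjI iffI) simp_all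
qed

end
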